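(* Let $I_1,\dots,I_g$ be nonempty proper subsets of $[K]$ satisfying $\bigcup_{d=1}^gI_d=[K]$, and let $F_d=\bigcap_{i\in I_d}E_i$ for $d\in[g]$. Let $\mathscr P_g$ be the set of permutations of $[g]$ and $\mathscr S_g=\{(w_1,\dots,w_g)\in(0,1)^g:\sum_{d=1}^gw_d=1\}$. Then the following assertions are equivalent: 1. There exists $\rho\in\mathscr P_g$ such that $P_{F_{\rho(1)}}\cdots P_{F_{\rho(g)}}$ has a spectral gap. 2. There exists $(w_1,\dots,w_g)\in\mathscr S_g$ such that $\sum_{d=1}^gw_dP_{F_d}$ has a spectral gap. 3. There exists $\rho\in\mathscr P_g$ such that $\|P_{F_{\rho(1)}}\cdots P_{F_{\rho(g)}}-\Pi\|<1$. 4. For every $\rho'\in\mathscr P_g$, $P_{F_{\rho'(1)}}\cdots P_{F_{\rho'(g)}}$ has a spectral gap. 5. For every $(w_1',\dots,w_g')\in\mathscr S_g$, $\sum_{d=1}^gw_d'P_{F_d}$ has a spectral gap. 6. For every $\rho'\in\mathscr P_g$, $\|P_{F_{\rho'(1)}}\cdots P_{F_{\rho'(g)}}-\Pi\|<1$.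
   Context: Let $K\ge 2$ be an integer and write $[n]=\{1,\dots,n\}$. For $k\in[K]$ let $\mathcal X_k$ be a complete separable metric space with its Borel $\sigma$-algebra, $\mathcal X=\mathcal X_1\times\cdots\times\mathcal X_K$, and let $\pi$ be a Borel probability measure on $\mathcal X$. $L^2(\pi)$ is the complex Hilbert space of square-integrable measurable functions $f:\mathcal X\to\mathbb C$ (identified when equal $\pi$-a.e.). For $I\subset[K]$, $x_I$ and $x_{-I}$ are the coordinates of $x$ with indices in $I$, respectively in $[K]\setminus I$, and $\mathcal X_I$ is the product of the $\mathcal X_i$, $i\in I$; $\pi(\cdot\mid x_{-I})$ is the (regular) conditional distribution of $X_I$ given $X_{-I}=x_{-I}$ when $X\sim\pi$. $\Pi f$ is the constant function $\int f\,d\pi$. $E_i$ is the closed subspace of functions in $L^2(\pi)$ that are constant with respect to the $i$th coordinate. For nonempty $I\subseteq[K]$, $\bigcap_{i\in I}E_i$ is the closed subspace of functions constant with respect to all coordinates in $I$, i.e. of classes having a representative depending only on $x_{-I}$ (the constants if $I=[K]$). For nonempty proper $I$ and $F=\bigcap_{i\in I}E_i$, $P_F$ is the orthogonal projection of $L^2(\pi)$ onto $F$, given by $(P_Ff)(x)=\int_{\mathcal X_I}f(x_I',x_{-I})\,\pi(dx_I'\mid x_{-I})$. $\|\cdot\|$ is the operator norm and $r(\cdot)$ the spectral radius. A bounded operator $Q$ on $L^2(\pi)$ that is a product or convex combination of such $P_F$ has a spectral gap if $r(Q-\Pi)<1$. *)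

theory Defs
  imports "HOL-Probability.Probability" "HOL-Combinatorics.Permutations"
begin

section \<open>Borel sets of an abstract topological space\<close>

definition borel_of :: "'a topology \<Rightarrow> 'a measure" where
  "borel_of T = sigma (topspace T) {U. openin T U}"


section \<open>The complex Hilbert space of square-integrable functions\<close>

text \<open>The elements of \<open>L2 M\<close> are genuine equivalence classes of functions
  modulo equality almost everywhere, so an operator is a map on classes. All
  operations are computed on representatives and do not depend on their choice.\<close>

type_synonym 'x l2_class = "('x \<Rightarrow> complex) set"

definition L2_funs :: "'x measure \<Rightarrow> ('x \<Rightarrow> complex) set" where
  "L2_funs M = {f \<in> borel_measurable M. integrable M (\<lambda>x. (cmod (f x))\<^sup>2)}"

definition L2_rel :: "'x measure \<Rightarrow> (('x \<Rightarrow> complex) \<times> ('x \<Rightarrow> complex)) set" where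
  "L2_rel M = {(f, h). f \<in> L2_funs M \<and> h \<in> L2_funs M \<and> (AE x in M. f x = h x)}"

definition L2 :: "'x measure \<Rightarrow> 'x l2_class set" where
  "L2 M = L2_funs M // L2_rel M"

definition L2_class :: "'x measure \<Rightarrow> ('x \<Rightarrow> complex) \<Rightarrow> 'x l2_class" where
  "L2_class M f = L2_rel M `` {f}"

definition rep :: "'x l2_class \<Rightarrow> 'x \<Rightarrow> complex" where
  "rep u = (SOME f. f \<in> u)"

definition L2_add :: "'x measure \<Rightarrow> 'x l2_class \<Rightarrow> 'x l2_class \<Rightarrow> 'x l2_class" where
  "L2_add M u v = L2_class M (\<lambda>x. rep u x + rep v x)"

definition L2_diff :: "'x measure \<Rightarrow> 'x l2_class \<Rightarrow> 'x l2_class \<Rightarrow> 'x l2_class" where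
  "L2_diff M u v = L2_class M (\<lambda>x. rep u x - rep v x)"

definition L2_scale :: "'x measure \<Rightarrow> complex \<Rightarrow> 'x l2_class \<Rightarrow> 'x l2_class" where
  "L2_scale M c u = L2_class M (\<lambda>x. c * rep u x)"

definition L2_inner :: "'x measure \<Rightarrow> 'x l2_class \<Rightarrow> 'x l2_class \<Rightarrow> complex" where
  "L2_inner M u v = (LINT x|M. rep u x * cnj (rep v x))"

definition L2_norm :: "'x measure \<Rightarrow> 'x l2_class \<Rightarrow> real" where
  "L2_norm M u = sqrt (LINT x|M. (cmod (rep u x))\<^sup>2)"


section \<open>Operators, operator norm and spectral radius\<close>

text \<open>Only the values of an operator on \<open>L2 M\<close> are relevant.\<close>

definition bounded_operator :: "'x measure \<Rightarrow> ('x l2_class \<Rightarrow> 'x l2_class) \<Rightarrow> bool" where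
  "bounded_operator M Q \<longleftrightarrow>
     (\<forall>u\<in>L2 M. Q u \<in> L2 M) \<and>
     (\<forall>u\<in>L2 M. \<forall>v\<in>L2 M. Q (L2_add M u v) = L2_add M (Q u) (Q v)) \<and>
     (\<forall>c. \<forall>u\<in>L2 M. Q (L2_scale M c u) = L2_scale M c (Q u)) \<and>
     (\<exists>C. \<forall>u\<in>L2 M. L2_norm M (Q u) \<le> C * L2_norm M u)"

definition op_norm :: "'x measure \<Rightarrow> ('x l2_class \<Rightarrow> 'x l2_class) \<Rightarrow> real" where
  "op_norm M Q = (SUP u\<in>{u \<in> L2 M. L2_norm M u \<le> 1}. L2_norm M (Q u))"

definition spectrum :: "'x measure \<Rightarrow> ('x l2_class \<Rightarrow> 'x l2_class) \<Rightarrow> complex set" where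
  "spectrum M Q = {z. \<not> (\<exists>R. bounded_operator M R \<and>
     (\<forall>u\<in>L2 M. R (L2_diff M (L2_scale M z u) (Q u)) = u \<and>
                L2_diff M (L2_scale M z (R u)) (Q (R u)) = u))}"

definition spectral_radius :: "'x measure \<Rightarrow> ('x l2_class \<Rightarrow> 'x l2_class) \<Rightarrow> real" where
  "spectral_radius M Q = (SUP z\<in>spectrum M Q. cmod z)"

definition op_diff :: "'x measure \<Rightarrow> ('x l2_class \<Rightarrow> 'x l2_class) \<Rightarrow>
    ('x l2_class \<Rightarrow> 'x l2_class) \<Rightarrow> 'x l2_class \<Rightarrow> 'x l2_class" where
  "op_diff M Q R u = L2_diff M (Q u) (R u)"

definition mean_op :: "'x measure \<Rightarrow> 'x l2_class \<Rightarrow> 'x l2_class" where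
  "mean_op M u = L2_class M (\<lambda>_. LINT x|M. rep u x)"

definition has_spectral_gap :: "'x measure \<Rightarrow> ('x l2_class \<Rightarrow> 'x l2_class) \<Rightarrow> bool" where
  "has_spectral_gap M Q \<longleftrightarrow> spectral_radius M (op_diff M Q (mean_op M)) < 1"

definition orth_proj :: "'x measure \<Rightarrow> 'x l2_class set \<Rightarrow> 'x l2_class \<Rightarrow> 'x l2_class" where
  "orth_proj M F u =
     (THE v. v \<in> F \<and> (\<forall>w\<in>F. L2_inner M (L2_diff M u v) w = 0))"


section \<open>Functions constant in some of the coordinates\<close>

text \<open>The closed subspace of classes having a representative that does not
  depend on the coordinates in \<open>I\<close>; for \<open>I = {i}\<close> it is \<open>E\<^sub>i\<close>. For larger
  \<open>I\<close> it is what is meant by the intersection of the \<open>E\<^sub>i\<close>, \<open>i \<in> I\<close>: a single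
  representative is constant in all these coordinates. The set-theoretic
  intersection of the sets of classes can be larger, for instance when the
  measure is concentrated on a diagonal.\<close>

definition const_in :: "nat \<Rightarrow> (nat \<Rightarrow> 'a) measure \<Rightarrow> nat set \<Rightarrow> (nat \<Rightarrow> 'a) l2_class set" where
  "const_in K M I = {u \<in> L2 M. \<exists>f\<in>u. \<forall>x\<in>space M. \<forall>y\<in>space M.
     (\<forall>i\<in>{1..K} - I. x i = y i) \<longrightarrow> f x = f y}"


section \<open>Products and convex combinations of operators\<close>

text \<open>\<open>op_prod g T = T 1 \<circ> T 2 \<circ> \<dots> \<circ> T g\<close>\<close>

definition op_prod :: "nat \<Rightarrow> (nat \<Rightarrow> 'b \<Rightarrow> 'b) \<Rightarrow> 'b \<Rightarrow> 'b" where
  "op_prod g T = foldr (\<circ>) (map T [1..<Suc g]) id"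

definition op_mix :: "'x measure \<Rightarrow> nat \<Rightarrow> (nat \<Rightarrow> real) \<Rightarrow>
    (nat \<Rightarrow> 'x l2_class \<Rightarrow> 'x l2_class) \<Rightarrow> 'x l2_class \<Rightarrow> 'x l2_class" where
  "op_mix M g w T u = L2_class M (\<lambda>x. \<Sum>d = 1..g. complex_of_real (w d) * rep (T d u) x)"

definition weights :: "nat \<Rightarrow> (nat \<Rightarrow> real) set" where
  "weights g = {w. (\<forall>d\<in>{1..g}. 0 < w d \<and> w d < 1) \<and> (\<Sum>d = 1..g. w d) = 1}"

definition all_equivalent :: "bool list \<Rightarrow> bool" where
  "all_equivalent ps \<longleftrightarrow> (\<forall>p\<in>set ps. \<forall>q\<in>set ps. p \<longleftrightarrow> q)"

end

theory Submission
  imports Defs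
begin

text \<open>All six statements are equivalent to the joint gap
  \<open>c \<parallel>u\<parallel>\<^sup>2 \<le> (\<Sum>d. \<parallel>u - P d u\<parallel>\<^sup>2)\<close> for some \<open>c > 0\<close> and all \<open>u\<close> of mean zero.
  If \<open>1\<close> is not in the spectrum of \<open>Q - \<Pi>\<close>, then \<open>\<parallel>u\<parallel> \<le> C \<parallel>u - Q u\<parallel>\<close>, and
  \<open>\<parallel>u - Q u\<parallel>\<close> is controlled by the \<open>\<parallel>u - P d u\<parallel>\<close>, both for a product and for a convex
  combination \<open>Q\<close>. Conversely, the joint gap makes \<open>Q\<close> a strict contraction on the mean-zero
  vectors: for a convex combination because \<open>\<parallel>Q u\<parallel>\<^sup>2 \<le> (\<Sum>d. w d \<parallel>P d u\<parallel>\<^sup>2)\<close>, and for a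
  product because a small loss of norm along the factors keeps every partial product close to
  \<open>u\<close>, hence \<open>u\<close> close to the range of every \<open>P d\<close>. Being zero on the constants,
  \<open>Q - \<Pi>\<close> has \<open>0\<close> in its spectrum, so the spectral radius is a supremum over a nonempty set.

  The projections exist because the functions constant in the coordinates of \<open>I\<close> are those
  measurable with respect to the \<open>\<sigma>\<close>-algebra of measurable sets that are saturated in these
  coordinates, so that \<open>P d\<close> is a conditional expectation.\<close>

section \<open>Classes of square-integrable functions\<close>

lemma L2_funs_measurable [measurable_dest]: "f \<in> L2_funs M \<Longrightarrow> f \<in> borel_measurable M"
  by (simp add: L2_funs_def)

lemma L2_funs_integrable: "f \<in> L2_funs M \<Longrightarrow> integrable M (\<lambda>x. (cmod (f x))\<^sup>2)"
  by (simp add: L2_funs_def)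

lemma L2_funs_bounded:
  assumes "h \<in> borel_measurable M" "integrable M g" "\<And>x. (cmod (h x))\<^sup>2 \<le> g x"
  shows "h \<in> L2_funs M"
proof -
  note [measurable] = assms(1)
  have "norm ((cmod (h x))\<^sup>2) \<le> norm (g x)" for x
    using assms(3)[of x] by simp
  then have "integrable M (\<lambda>x. (cmod (h x))\<^sup>2)"
    by (intro Bochner_Integration.integrable_bound[OF assms(2)]) auto
  with assms(1) show ?thesis by (simp add: L2_funs_def)
qed

lemma cmod_add_power2_le: "(cmod (a + b))\<^sup>2 \<le> 2 * (cmod a)\<^sup>2 + 2 * (cmod b)\<^sup>2"
proof -
  have "(cmod (a + b))\<^sup>2 \<le> (cmod a + cmod b)\<^sup>2"
    by (simp add: norm_triangle_ineq power_mono)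
  also have "\<dots> \<le> 2 * (cmod a)\<^sup>2 + 2 * (cmod b)\<^sup>2"
    using sum_squares_bound[of "cmod a" "cmod b"] by (simp add: power2_sum)
  finally show ?thesis .
qed

lemma L2_funs_add:
  assumes f: "f \<in> L2_funs M" and h: "h \<in> L2_funs M"
  shows "(\<lambda>x. f x + h x) \<in> L2_funs M"
proof -
  note [measurable] = f h
  show ?thesis
    by (rule L2_funs_bounded[where g="\<lambda>x. 2 * (cmod (f x))\<^sup>2 + 2 * (cmod (h x))\<^sup>2"])
      (use L2_funs_integrable[OF f] L2_funs_integrable[OF h] in \<open>auto intro!: cmod_add_power2_le\<close>)
qed

lemma L2_funs_scale:
  assumes f: "f \<in> L2_funs M"
  shows "(\<lambda>x. c * f x) \<in> L2_funs M"
proof -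
  note [measurable] = f
  show ?thesis
    by (rule L2_funs_bounded[where g="\<lambda>x. (cmod c)\<^sup>2 * (cmod (f x))\<^sup>2"])
      (use L2_funs_integrable[OF f] in \<open>auto simp: norm_mult power_mult_distrib\<close>)
qed

lemma L2_funs_diff:
  assumes "f \<in> L2_funs M" "h \<in> L2_funs M"
  shows "(\<lambda>x. f x - h x) \<in> L2_funs M"
  using L2_funs_add[OF assms(1) L2_funs_scale[OF assms(2), of "-1"]] by simp

lemma L2_funs_0: "(\<lambda>x. 0) \<in> L2_funs M"
  by (simp add: L2_funs_def)

lemma L2_funs_sum:
  assumes "\<And>i. i \<in> A \<Longrightarrow> f i \<in> L2_funs M"
  shows "(\<lambda>x. \<Sum>i\<in>A. f i x) \<in> L2_funs M"
  using assms by (induction A rule: infinite_finite_induct) (auto intro: L2_funs_0 L2_funs_add)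

lemma borel_measurable_cnj [measurable]:
  "f \<in> borel_measurable M \<Longrightarrow> (\<lambda>x. cnj (f x)) \<in> borel_measurable M"
  by (rule borel_measurable_continuous_on[where f=cnj]) (auto intro!: continuous_intros)

lemma L2_funs_integrable_mult:
  assumes f: "f \<in> L2_funs M" and h: "h \<in> L2_funs M"
  shows "integrable M (\<lambda>x. f x * cnj (h x))"
proof -
  note [measurable] = f h
  have ab: "a * b \<le> a\<^sup>2 + b\<^sup>2" if "a \<ge> 0" "b \<ge> 0" for a b :: real
    using sum_squares_bound[of a b] mult_nonneg_nonneg[OF that] by simp
  have "norm (f x * cnj (h x)) \<le> norm ((cmod (f x))\<^sup>2 + (cmod (h x))\<^sup>2)" for x
    using ab[of "cmod (f x)" "cmod (h x)"] by (simp add: norm_mult)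
  then have "AE x in M. norm (f x * cnj (h x)) \<le> norm ((cmod (f x))\<^sup>2 + (cmod (h x))\<^sup>2)"
    by blast
  moreover have "integrable M (\<lambda>x. (cmod (f x))\<^sup>2 + (cmod (h x))\<^sup>2)"
    by (intro Bochner_Integration.integrable_add L2_funs_integrable f h)
  moreover have "(\<lambda>x. f x * cnj (h x)) \<in> borel_measurable M"
    by measurable
  ultimately show ?thesis
    by (rule Bochner_Integration.integrable_bound[rotated 2])
qed

lemma equiv_L2_rel: "equiv (L2_funs M) (L2_rel M)"
proof (rule equivI)
  show "L2_rel M \<subseteq> L2_funs M \<times> L2_funs M" "refl_on (L2_funs M) (L2_rel M)" "sym (L2_rel M)"
    by (auto simp: L2_rel_def refl_on_def sym_def)
  show "trans (L2_rel M)"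
    unfolding L2_rel_def
    by (rule transI) (auto elim: eventually_elim2)
qed

lemma L2_class_in_L2: "f \<in> L2_funs M \<Longrightarrow> L2_class M f \<in> L2 M"
  by (simp add: L2_def L2_class_def quotientI)

lemma rep_in: "u \<in> L2 M \<Longrightarrow> rep u \<in> u"
  unfolding rep_def L2_def using in_quotient_imp_non_empty[OF equiv_L2_rel]
  by (metis some_in_eq)

lemma L2_class_eq:
  assumes "u \<in> L2 M" "f \<in> u"
  shows "L2_class M f = u"
  using assms equiv_L2_rel[of M] unfolding L2_def L2_class_def
  by (metis Image_singleton_iff equiv_class_eq quotientE)

lemma L2_mem_funs: "u \<in> L2 M \<Longrightarrow> f \<in> u \<Longrightarrow> f \<in> L2_funs M"
  using in_quotient_imp_subset[OF equiv_L2_rel] unfolding L2_def by blast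

lemma rep_L2_funs: "u \<in> L2 M \<Longrightarrow> rep u \<in> L2_funs M"
  using L2_mem_funs rep_in by blast

lemma L2_class_rep: "u \<in> L2 M \<Longrightarrow> L2_class M (rep u) = u"
  using L2_class_eq rep_in by blast

lemma L2_class_eq_iff:
  assumes "f \<in> L2_funs M" "h \<in> L2_funs M"
  shows "L2_class M f = L2_class M h \<longleftrightarrow> (AE x in M. f x = h x)"
  using eq_equiv_class_iff[OF equiv_L2_rel assms] assms
  by (simp add: L2_class_def L2_rel_def)

lemma L2_eq_iff:
  assumes "u \<in> L2 M" "v \<in> L2 M"
  shows "u = v \<longleftrightarrow> (AE x in M. rep u x = rep v x)"
  using L2_class_eq_iff[of "rep u" M "rep v"] assms by (simp add: L2_class_rep rep_L2_funs)

lemma rep_L2_class: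
  assumes "f \<in> L2_funs M"
  shows "AE x in M. rep (L2_class M f) x = f x"
  using assms L2_class_eq_iff by (metis L2_class_in_L2 L2_class_rep rep_L2_funs)

section \<open>Linear operations on classes and the zero class\<close>

lemma L2_add_in [simp]: "u \<in> L2 M \<Longrightarrow> v \<in> L2 M \<Longrightarrow> L2_add M u v \<in> L2 M"
  by (simp add: L2_add_def L2_class_in_L2 L2_funs_add rep_L2_funs)

lemma L2_diff_in [simp]: "u \<in> L2 M \<Longrightarrow> v \<in> L2 M \<Longrightarrow> L2_diff M u v \<in> L2 M"
  by (simp add: L2_diff_def L2_class_in_L2 L2_funs_diff rep_L2_funs)

lemma L2_scale_in [simp]: "u \<in> L2 M \<Longrightarrow> L2_scale M c u \<in> L2 M"
  by (simp add: L2_scale_def L2_class_in_L2 L2_funs_scale rep_L2_funs)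

text \<open>\<open>rep\<close> picks an arbitrary member of a class, so it respects the operations
  only up to a null set. Identities between classes are therefore proved almost everywhere and
  transferred by \<open>L2_eqI\<close>.\<close>

lemma rep_L2_add:
  "u \<in> L2 M \<Longrightarrow> v \<in> L2 M \<Longrightarrow> AE x in M. rep (L2_add M u v) x = rep u x + rep v x"
  unfolding L2_add_def by (intro rep_L2_class L2_funs_add rep_L2_funs)

lemma rep_L2_diff:
  "u \<in> L2 M \<Longrightarrow> v \<in> L2 M \<Longrightarrow> AE x in M. rep (L2_diff M u v) x = rep u x - rep v x"
  unfolding L2_diff_def by (intro rep_L2_class L2_funs_diff rep_L2_funs)

lemma rep_L2_scale:
  "u \<in> L2 M \<Longrightarrow> AE x in M. rep (L2_scale M c u) x = c * rep u x"
  unfolding L2_scale_def by (intro rep_L2_class L2_funs_scale rep_L2_funs)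

definition L2_zero :: "'x measure \<Rightarrow> 'x l2_class" where
  "L2_zero M = L2_class M (\<lambda>_. 0)"

lemma L2_zero_in [simp]: "L2_zero M \<in> L2 M"
  by (simp add: L2_zero_def L2_class_in_L2 L2_funs_0)

lemma rep_L2_zero: "AE x in M. rep (L2_zero M) x = 0"
  unfolding L2_zero_def by (intro rep_L2_class L2_funs_0)

lemma L2_eqI:
  assumes "u \<in> L2 M" "v \<in> L2 M" "AE x in M. rep u x = rep v x"
  shows "u = v"
  using assms L2_eq_iff by blast

lemma L2_diff_self: "u \<in> L2 M \<Longrightarrow> L2_diff M u u = L2_zero M"
  using rep_L2_diff[of u M u] rep_L2_zero[of M]
  by (intro L2_eqI) auto

lemma L2_diff_zero [simp]: "u \<in> L2 M \<Longrightarrow> L2_diff M u (L2_zero M) = u"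
  using rep_L2_diff[of u M "L2_zero M"] rep_L2_zero[of M]
  by (intro L2_eqI) auto

lemma L2_diff_diff_diff_left:
  assumes [simp]: "u \<in> L2 M" "v \<in> L2 M" "w \<in> L2 M"
  shows "L2_diff M (L2_diff M u v) (L2_diff M u w) = L2_diff M w v"
proof (rule L2_eqI)
  show "AE x in M. rep (L2_diff M (L2_diff M u v) (L2_diff M u w)) x = rep (L2_diff M w v) x"
    using rep_L2_diff[of u M v, simplified] rep_L2_diff[of u M w, simplified] rep_L2_diff[of w M v, simplified]
      rep_L2_diff[of "L2_diff M u v" M "L2_diff M u w", simplified]
    by eventually_elim simp
qed auto

lemma L2_add_diff_diff:
  assumes [simp]: "u \<in> L2 M" "v \<in> L2 M" "w \<in> L2 M"
  shows "L2_add M (L2_diff M u v) (L2_diff M v w) = L2_diff M u w"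
proof (rule L2_eqI)
  show "AE x in M. rep (L2_add M (L2_diff M u v) (L2_diff M v w)) x = rep (L2_diff M u w) x"
    using rep_L2_diff[of u M v, simplified] rep_L2_diff[of u M w, simplified] rep_L2_diff[of v M w, simplified]
      rep_L2_add[of "L2_diff M u v" M "L2_diff M v w", simplified]
    by eventually_elim simp
qed auto

lemma L2_diff_conv_add:
  assumes [simp]: "u \<in> L2 M" "v \<in> L2 M"
  shows "L2_diff M u v = L2_add M u (L2_scale M (-1) v)"
proof (rule L2_eqI)
  show "AE x in M. rep (L2_diff M u v) x = rep (L2_add M u (L2_scale M (-1) v)) x"
    using rep_L2_diff[of u M v, simplified] rep_L2_scale[of v M "-1", simplified]
      rep_L2_add[of u M "L2_scale M (-1) v", simplified]
    by eventually_elim simp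
qed auto

lemma L2_scale_diff:
  assumes [simp]: "u \<in> L2 M" "v \<in> L2 M"
  shows "L2_scale M c (L2_diff M u v) = L2_diff M (L2_scale M c u) (L2_scale M c v)"
proof (rule L2_eqI)
  show "AE x in M. rep (L2_scale M c (L2_diff M u v)) x = rep (L2_diff M (L2_scale M c u) (L2_scale M c v)) x"
    using rep_L2_diff[OF assms] rep_L2_scale[OF assms(1), of c] rep_L2_scale[OF assms(2), of c]
      rep_L2_scale[OF L2_diff_in[OF assms], of c]
      rep_L2_diff[OF L2_scale_in[OF assms(1), of c] L2_scale_in[OF assms(2), of c]]
    by eventually_elim (simp add: right_diff_distrib)
qed auto

section \<open>The norm and the metric it induces\<close>

lemma L2_norm_nonneg [simp]: "0 \<le> L2_norm M u"
  by (simp add: L2_norm_def)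

lemma L2_norm_power2: "(L2_norm M u)\<^sup>2 = (LINT x|M. (cmod (rep u x))\<^sup>2)"
  by (simp add: L2_norm_def)

lemma L2_norm_cong:
  assumes "u \<in> L2 M" "f \<in> borel_measurable M" "AE x in M. rep u x = f x"
  shows "(L2_norm M u)\<^sup>2 = (LINT x|M. (cmod (f x))\<^sup>2)"
proof -
  note [measurable] = rep_L2_funs[OF assms(1)] assms(2)
  show ?thesis
    unfolding L2_norm_power2 using assms(3) by (intro integral_cong_AE) auto
qed

lemma L2_norm_eq_0_iff:
  assumes "u \<in> L2 M"
  shows "L2_norm M u = 0 \<longleftrightarrow> u = L2_zero M"
proof -
  have "L2_norm M u = 0 \<longleftrightarrow> (LINT x|M. (cmod (rep u x))\<^sup>2) = 0"
    by (simp add: L2_norm_def)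
  also have "\<dots> \<longleftrightarrow> (AE x in M. (cmod (rep u x))\<^sup>2 = 0)"
    by (intro integral_nonneg_eq_0_iff_AE L2_funs_integrable rep_L2_funs assms) auto
  also have "\<dots> \<longleftrightarrow> u = L2_zero M"
    using rep_L2_zero[of M] by (auto simp: L2_eq_iff[OF assms])
  finally show ?thesis .
qed

lemma L2_norm_zero [simp]: "L2_norm M (L2_zero M) = 0"
  by (simp add: L2_norm_eq_0_iff)

lemma L2_norm_scale:
  assumes "u \<in> L2 M"
  shows "L2_norm M (L2_scale M c u) = cmod c * L2_norm M u"
proof -
  note [measurable] = rep_L2_funs[OF assms]
  have "(L2_norm M (L2_scale M c u))\<^sup>2 = (LINT x|M. (cmod (c * rep u x))\<^sup>2)"
    using assms rep_L2_scale[OF assms, of c] by (intro L2_norm_cong) auto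
  also have "\<dots> = (cmod c * L2_norm M u)\<^sup>2"
    by (simp add: norm_mult power_mult_distrib L2_norm_power2)
  finally show ?thesis by (simp add: power2_eq_iff_nonneg)
qed

text \<open>Weighting by \<open>t = \<parallel>v\<parallel> / \<parallel>u\<parallel>\<close> in \<open>\<bar>a + b\<bar>\<^sup>2 \<le> (1 + t) \<bar>a\<bar>\<^sup>2 + (1 + 1/t) \<bar>b\<bar>\<^sup>2\<close>
  avoids the Cauchy--Schwarz inequality.\<close>

lemma L2_norm_triangle:
  assumes u: "u \<in> L2 M" and v: "v \<in> L2 M"
  shows "L2_norm M (L2_add M u v) \<le> L2_norm M u + L2_norm M v"
\<comment> \<open>The weight t and its inverse divide by the two norms, so zero vectors are treated
  apart.\<close>
proof (cases "u = L2_zero M \<or> v = L2_zero M")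
  case True
  then show ?thesis
  proof
    assume "u = L2_zero M"
    with rep_L2_add[OF u v] rep_L2_zero[of M] u v have "L2_add M u v = v"
      by (intro L2_eqI[of _ M]) auto
    then show ?thesis by simp
  next
    assume "v = L2_zero M"
    with rep_L2_add[OF u v] rep_L2_zero[of M] u v have "L2_add M u v = u"
      by (intro L2_eqI[of _ M]) auto
    then show ?thesis by simp
  qed
next
  case False
  note [measurable] = rep_L2_funs[OF u] rep_L2_funs[OF v]
  define a where "a = L2_norm M u"
  define b where "b = L2_norm M v"
  have "a > 0" "b > 0"
    using False L2_norm_eq_0_iff[OF u] L2_norm_eq_0_iff[OF v] L2_norm_nonneg[of M u] L2_norm_nonneg[of M v]
    unfolding a_def b_def by linarith+
  have pt: "(cmod (x + y))\<^sup>2 \<le> (1 + b/a) * (cmod x)\<^sup>2 + (1 + a/b) * (cmod y)\<^sup>2" for x y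
  proof -
    have "0 \<le> (b * cmod x - a * cmod y)\<^sup>2 / (a * b)"
      using \<open>a > 0\<close> \<open>b > 0\<close> by simp
    also have "\<dots> = b/a * (cmod x)\<^sup>2 + a/b * (cmod y)\<^sup>2 - 2 * cmod x * cmod y"
      using \<open>a > 0\<close> \<open>b > 0\<close> by (simp add: field_simps power2_eq_square)
    finally have "(cmod x + cmod y)\<^sup>2 \<le> (1 + b/a) * (cmod x)\<^sup>2 + (1 + a/b) * (cmod y)\<^sup>2"
      by (simp add: power2_sum algebra_simps)
    moreover have "(cmod (x + y))\<^sup>2 \<le> (cmod x + cmod y)\<^sup>2"
      by (simp add: norm_triangle_ineq power_mono)
    ultimately show ?thesis by linarith
  qed
  have "(L2_norm M (L2_add M u v))\<^sup>2 = (LINT x|M. (cmod (rep u x + rep v x))\<^sup>2)"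
    using u v rep_L2_add[OF u v] by (intro L2_norm_cong) auto
  also have "\<dots> \<le> (LINT x|M. (1 + b/a) * (cmod (rep u x))\<^sup>2 + (1 + a/b) * (cmod (rep v x))\<^sup>2)"
  proof (rule integral_mono)
    show "integrable M (\<lambda>x. (cmod (rep u x + rep v x))\<^sup>2)"
      by (intro L2_funs_integrable L2_funs_add rep_L2_funs u v)
    show "integrable M (\<lambda>x. (1 + b/a) * (cmod (rep u x))\<^sup>2 + (1 + a/b) * (cmod (rep v x))\<^sup>2)"
      by (intro Bochner_Integration.integrable_add integrable_mult_right L2_funs_integrable rep_L2_funs u v)
  qed (rule pt)
  also have "\<dots> = (1 + b/a) * a\<^sup>2 + (1 + a/b) * b\<^sup>2"
    using u v by (simp add: L2_funs_integrable rep_L2_funs a_def b_def L2_norm_power2)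
  also have "\<dots> = (a + b)\<^sup>2"
    using \<open>a > 0\<close> \<open>b > 0\<close> by (simp add: field_simps power2_eq_square)
  finally have "L2_norm M (L2_add M u v) \<le> a + b"
    by (rule power2_le_imp_le) (use \<open>a > 0\<close> \<open>b > 0\<close> in simp)
  then show ?thesis by (simp only: a_def b_def)
qed

text \<open>No membership in \<open>L2 M\<close> is assumed, because \<open>Metric_space\<close>
  demands symmetry on the whole type.\<close>

lemma L2_norm_diff_commute: "L2_norm M (L2_diff M u v) = L2_norm M (L2_diff M v u)"
proof (cases "(\<lambda>x. rep u x - rep v x) \<in> L2_funs M")
  case True
  have *: "(\<lambda>x. rep v x - rep u x) \<in> L2_funs M"
    using L2_funs_scale[OF True, of "-1"] by simp
  note [measurable] = True *
  have "(L2_norm M (L2_diff M u v))\<^sup>2 = (LINT x|M. (cmod (rep u x - rep v x))\<^sup>2)"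
    using True unfolding L2_diff_def by (intro L2_norm_cong rep_L2_class L2_class_in_L2) auto
  also have "\<dots> = (LINT x|M. (cmod (rep v x - rep u x))\<^sup>2)"
    by (simp add: norm_minus_commute)
  also have "\<dots> = (L2_norm M (L2_diff M v u))\<^sup>2"
    using * unfolding L2_diff_def by (intro L2_norm_cong[symmetric] rep_L2_class L2_class_in_L2) auto
  finally show ?thesis by (simp add: power2_eq_iff_nonneg)
next
  case False
  then have "(\<lambda>x. rep v x - rep u x) \<notin> L2_funs M"
    using L2_funs_scale[of "\<lambda>x. rep v x - rep u x" M "-1"] by auto
  \<comment> \<open>\<open>L2_rel\<close> relates only square-integrable functions, so the class of
    any other function is the empty set.\<close>
  then have "L2_diff M u v = {}" "L2_diff M v u = {}"
    using False by (auto simp: L2_diff_def L2_class_def L2_rel_def)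
  then show ?thesis by simp
qed

lemma L2_diff_eq_zero_iff:
  assumes "u \<in> L2 M" "v \<in> L2 M"
  shows "L2_diff M u v = L2_zero M \<longleftrightarrow> u = v"
proof -
  have "L2_diff M u v = L2_zero M \<longleftrightarrow> (AE x in M. rep u x = rep v x)"
    using assms rep_L2_diff[OF assms] rep_L2_zero[of M]
    by (subst L2_eq_iff[of _ M]) auto
  with L2_eq_iff[OF assms] show ?thesis by blast
qed

text \<open>Gives access to completeness and to Banach's fixed point theorem on classes.\<close>

lemma Metric_space_L2: "Metric_space (L2 M) (\<lambda>u v. L2_norm M (L2_diff M u v))"
proof
  show "L2_norm M (L2_diff M u v) = L2_norm M (L2_diff M v u)" for u v
    by (rule L2_norm_diff_commute)
  show "L2_norm M (L2_diff M u v) = 0 \<longleftrightarrow> u = v" if "u \<in> L2 M" "v \<in> L2 M" for u v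
    using that by (simp add: L2_norm_eq_0_iff L2_diff_eq_zero_iff)
  show "L2_norm M (L2_diff M u w) \<le> L2_norm M (L2_diff M u v) + L2_norm M (L2_diff M v w)"
    if "u \<in> L2 M" "v \<in> L2 M" "w \<in> L2 M" for u v w
    using L2_norm_triangle[of "L2_diff M u v" M "L2_diff M v w"] that
    by (simp add: L2_add_diff_diff)
qed simp

section \<open>Completeness\<close>

text \<open>The dominating function 1 + |f|^2 is integrable because the total mass is
  finite.\<close>

lemma (in prob_space) L2_funs_imp_integrable:
  assumes f: "f \<in> L2_funs M"
  shows "integrable M f"
proof (rule Bochner_Integration.integrable_bound)
  note [measurable] = f
  show "integrable M (\<lambda>x. 1 + (cmod (f x))\<^sup>2)"
    by (intro Bochner_Integration.integrable_add L2_funs_integrable f) simp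
  show "f \<in> borel_measurable M" by simp
  \<comment> \<open>Expanding (t - 1/2)^2 \<ge> 0 gives t \<le> t^2 + 1/4.\<close>
  have "t \<le> 1 + t\<^sup>2" for t :: real
    using zero_le_power2[of "t - 1/2"] zero_le_power2[of t] by (simp only: power2_diff) (simp add: power_divide)
  then show "AE x in M. norm (f x) \<le> norm (1 + (cmod (f x))\<^sup>2)"
    by (intro AE_I2) (simp add: abs_of_nonneg)
qed

text \<open>The difference of the two sides is the variance of |f|, which is nonnegative.\<close>

lemma (in prob_space) integral_cmod_power2_le:
  assumes f: "f \<in> L2_funs M"
  shows "(LINT x|M. cmod (f x))\<^sup>2 \<le> (LINT x|M. (cmod (f x))\<^sup>2)"
proof -
  have "variance (\<lambda>x. cmod (f x)) = (LINT x|M. (cmod (f x))\<^sup>2) - (LINT x|M. cmod (f x))\<^sup>2"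
    by (intro variance_eq integrable_norm L2_funs_imp_integrable L2_funs_integrable f)
  moreover have "variance (\<lambda>x. cmod (f x)) \<ge> 0"
    by (rule variance_positive)
  ultimately show ?thesis by linarith
qed

text \<open>Riesz-Fischer. On a probability space an L2-Cauchy sequence is L1-Cauchy, so a
  subsequence converges almost everywhere; Fatou's lemma then makes its pointwise limit the L2-limit
  of the whole sequence.\<close>

lemma (in prob_space) mcomplete_L2: "Metric_space.mcomplete (L2 M) (\<lambda>u v. L2_norm M (L2_diff M u v))"
proof -
  interpret L: Metric_space "L2 M" "\<lambda>u v. L2_norm M (L2_diff M u v)"
    by (rule Metric_space_L2)
  have "\<exists>l. limitin L.mtopology \<sigma> l sequentially" if \<sigma>: "L.MCauchy \<sigma>" for \<sigma>
  proof -
    define f where "f n = rep (\<sigma> n)" for n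
    have \<sigma>L: "\<sigma> n \<in> L2 M" for n
      using \<sigma> by (auto simp: L.MCauchy_def)
    then have fL: "f n \<in> L2_funs M" for n
      by (simp add: f_def rep_L2_funs)
    note [measurable] = fL
    have N: "(L2_norm M (L2_diff M (\<sigma> i) (\<sigma> j)))\<^sup>2 = (LINT x|M. (cmod (f i x - f j x))\<^sup>2)" for i j
      using rep_L2_diff[OF \<sigma>L \<sigma>L, of i j] \<sigma>L by (intro L2_norm_cong) (auto simp: f_def[symmetric])
    have cau: "\<exists>N. \<forall>i\<ge>N. \<forall>j\<ge>N. L2_norm M (L2_diff M (\<sigma> i) (\<sigma> j)) < e" if "e > 0" for e
      using \<sigma> that unfolding L.MCauchy_def by meson
    have L1: "(LINT x|M. cmod (f i x - f j x)) \<le> L2_norm M (L2_diff M (\<sigma> i) (\<sigma> j))" for i j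
      using integral_cmod_power2_le[OF L2_funs_diff[OF fL fL], of i j]
      unfolding N[symmetric] by (rule power2_le_imp_le) simp
    have "\<exists>N. \<forall>i\<ge>N. \<forall>j\<ge>N. (LINT x|M. cmod (f i x - f j x)) < e" if "e > 0" for e
      using cau[OF that] L1 by (meson le_less_trans)
    then obtain r where r: "strict_mono r" "AE x in M. Cauchy (\<lambda>i. f (r i) x)"
      using cauchy_L1_AE_cauchy_subseq[of M f] L2_funs_imp_integrable[OF fL] by blast
    \<comment> \<open>Where the subsequence diverges, \<open>lim\<close> has an unspecified value.
      This concerns a null set only, and h is measurable all the same.\<close>
    define h where "h x = lim (\<lambda>i. f (r i) x)" for x
    have [measurable]: "h \<in> borel_measurable M"
      unfolding h_def by (rule borel_measurable_lim_metric) simp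
    have lim: "AE x in M. (\<lambda>i. f (r i) x) \<longlonglongrightarrow> h x"
      using r(2) by eventually_elim (simp add: h_def Cauchy_convergent_iff convergent_LIMSEQ_iff)
    \<comment> \<open>Fatou's lemma along the subsequence with n fixed: the Cauchy bound between
      members passes to the distance from the limit.\<close>
    have fatou: "(\<integral>\<^sup>+x. ennreal ((cmod (h x - f n x))\<^sup>2) \<partial>M) \<le> ennreal (e\<^sup>2)"
      if n: "n \<ge> N" and NN: "\<And>i j. i \<ge> N \<Longrightarrow> j \<ge> N \<Longrightarrow> L2_norm M (L2_diff M (\<sigma> i) (\<sigma> j)) < e" for n N e
    proof -
      have "(\<integral>\<^sup>+x. ennreal ((cmod (h x - f n x))\<^sup>2) \<partial>M)
          = (\<integral>\<^sup>+x. liminf (\<lambda>i. ennreal ((cmod (f (r i) x - f n x))\<^sup>2)) \<partial>M)"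
      proof (rule nn_integral_cong_AE)
        show "AE x in M. ennreal ((cmod (h x - f n x))\<^sup>2) = liminf (\<lambda>i. ennreal ((cmod (f (r i) x - f n x))\<^sup>2))"
          using lim
        proof eventually_elim
          case (elim x)
          then have "(\<lambda>i. ennreal ((cmod (f (r i) x - f n x))\<^sup>2)) \<longlonglongrightarrow> ennreal ((cmod (h x - f n x))\<^sup>2)"
            by (intro tendsto_intros tendsto_ennrealI)
          from lim_imp_Liminf[OF _ this] show ?case by simp
        qed
      qed
      also have "\<dots> \<le> liminf (\<lambda>i. \<integral>\<^sup>+x. ennreal ((cmod (f (r i) x - f n x))\<^sup>2) \<partial>M)"
        by (intro nn_integral_liminf) measurable
      also have "\<dots> \<le> ennreal (e\<^sup>2)"
      proof (rule Liminf_le)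
        show "\<forall>\<^sub>F i in sequentially. (\<integral>\<^sup>+x. ennreal ((cmod (f (r i) x - f n x))\<^sup>2) \<partial>M) \<le> ennreal (e\<^sup>2)"
          using eventually_ge_at_top[of N]
        proof eventually_elim
          case (elim i)
          then have "r i \<ge> N" using seq_suble[OF r(1)] le_trans by blast
          have "(\<integral>\<^sup>+x. ennreal ((cmod (f (r i) x - f n x))\<^sup>2) \<partial>M)
              = ennreal (LINT x|M. (cmod (f (r i) x - f n x))\<^sup>2)"
            by (intro nn_integral_eq_integral L2_funs_integrable L2_funs_diff fL) simp
          also have "\<dots> \<le> ennreal (e\<^sup>2)"
            unfolding N[symmetric] using NN[OF \<open>r i \<ge> N\<close> n]
            by (intro ennreal_leI power_mono) auto
          finally show ?case .
        qed
      qed simp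
      finally show ?thesis .
    qed
    obtain N1 where N1: "L2_norm M (L2_diff M (\<sigma> i) (\<sigma> j)) < 1" if "i \<ge> N1" "j \<ge> N1" for i j
      using cau[of 1] by auto
    \<comment> \<open>Membership of h is obtained by writing it as (h - f N1) + f N1, both
      square-integrable.\<close>
    have "(\<integral>\<^sup>+x. ennreal ((cmod (h x - f N1 x))\<^sup>2) \<partial>M) < \<infinity>"
      using le_less_trans[OF fatou[OF order_refl N1] ennreal_less_top] by simp
    then have "(\<lambda>x. h x - f N1 x) \<in> L2_funs M"
      unfolding L2_funs_def by (auto intro!: integrableI_bounded)
    from L2_funs_add[OF this fL[of N1]] have hL: "h \<in> L2_funs M" by simp
    define l where "l = L2_class M h"
    have l: "l \<in> L2 M" by (simp add: l_def L2_class_in_L2 hL)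
    have "limitin L.mtopology \<sigma> l sequentially"
      unfolding L.limitin_metric
    proof (intro conjI allI impI l)
      fix e :: real assume "e > 0"
      \<comment> \<open>Fatou's lemma yields only a weak inequality; starting from e/2 makes the
        final one strict.\<close>
      then obtain N where NN: "L2_norm M (L2_diff M (\<sigma> i) (\<sigma> j)) < e/2" if "i \<ge> N" "j \<ge> N" for i j
        using cau[of "e/2"] by auto
      show "\<forall>\<^sub>F n in sequentially. \<sigma> n \<in> L2 M \<and> L2_norm M (L2_diff M (\<sigma> n) l) < e"
        using eventually_ge_at_top[of N]
      proof eventually_elim
        case (elim n)
        have "AE x in M. rep (L2_diff M l (\<sigma> n)) x = h x - f n x"
          using rep_L2_diff[OF l \<sigma>L[of n]] rep_L2_class[OF hL]
          by eventually_elim (simp add: l_def f_def)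
        then have "(L2_norm M (L2_diff M l (\<sigma> n)))\<^sup>2 = (LINT x|M. (cmod (h x - f n x))\<^sup>2)"
          using l \<sigma>L by (intro L2_norm_cong) auto
        also have "ennreal \<dots> = (\<integral>\<^sup>+x. ennreal ((cmod (h x - f n x))\<^sup>2) \<partial>M)"
          by (intro nn_integral_eq_integral[symmetric] L2_funs_integrable L2_funs_diff fL hL) simp
        also have "\<dots> \<le> ennreal ((e/2)\<^sup>2)"
          by (rule fatou[OF elim NN])
        finally have "(L2_norm M (L2_diff M l (\<sigma> n)))\<^sup>2 \<le> (e/2)\<^sup>2"
          by (simp add: ennreal_le_iff)
        then have "L2_norm M (L2_diff M l (\<sigma> n)) \<le> e/2"
          by (rule power2_le_imp_le) (use \<open>e > 0\<close> in simp)
        then show ?case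
          using \<open>e > 0\<close> \<sigma>L by (simp add: L2_norm_diff_commute[of M "\<sigma> n"])
      qed
    qed
    then show ?thesis by blast
  qed
  then show ?thesis by (simp add: L.mcomplete_def)
qed

section \<open>Bounded operators and their spectrum\<close>

lemma bounded_operator_in: "bounded_operator M Q \<Longrightarrow> u \<in> L2 M \<Longrightarrow> Q u \<in> L2 M"
  and bounded_operator_add: "bounded_operator M Q \<Longrightarrow> u \<in> L2 M \<Longrightarrow> v \<in> L2 M \<Longrightarrow>
    Q (L2_add M u v) = L2_add M (Q u) (Q v)"
  and bounded_operator_scale: "bounded_operator M Q \<Longrightarrow> u \<in> L2 M \<Longrightarrow>
    Q (L2_scale M c u) = L2_scale M c (Q u)"
  by (auto simp: bounded_operator_def)

lemma bounded_operator_diff: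
  assumes "bounded_operator M Q" "u \<in> L2 M" "v \<in> L2 M"
  shows "Q (L2_diff M u v) = L2_diff M (Q u) (Q v)"
  using assms
  by (simp add: L2_diff_conv_add bounded_operator_in bounded_operator_add bounded_operator_scale)

lemma bounded_operator_zero:
  assumes "bounded_operator M Q"
  shows "Q (L2_zero M) = L2_zero M"
  using bounded_operator_diff[OF assms L2_zero_in L2_zero_in] assms
  by (simp add: L2_diff_self bounded_operator_in)

text \<open>The constant in \<open>bounded_operator\<close> may be negative; a nonnegative one lets
  bounds be multiplied and chained.\<close>

lemma bounded_operator_bound:
  assumes "bounded_operator M Q"
  obtains C where "C \<ge> 0" "\<And>u. u \<in> L2 M \<Longrightarrow> L2_norm M (Q u) \<le> C * L2_norm M u"
proof -
  obtain C where C: "\<And>u. u \<in> L2 M \<Longrightarrow> L2_norm M (Q u) \<le> C * L2_norm M u"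
    using assms unfolding bounded_operator_def by blast
  have "L2_norm M (Q u) \<le> max C 0 * L2_norm M u" if "u \<in> L2 M" for u
    by (rule order_trans[OF C[OF that]]) (simp add: mult_right_mono)
  then show ?thesis by (intro that[of "max C 0"]) auto
qed

lemma bounded_operatorI:
  assumes "\<And>u. u \<in> L2 M \<Longrightarrow> Q u \<in> L2 M"
    and "\<And>u v. u \<in> L2 M \<Longrightarrow> v \<in> L2 M \<Longrightarrow> Q (L2_add M u v) = L2_add M (Q u) (Q v)"
    and "\<And>c u. u \<in> L2 M \<Longrightarrow> Q (L2_scale M c u) = L2_scale M c (Q u)"
    and "\<And>u. u \<in> L2 M \<Longrightarrow> L2_norm M (Q u) \<le> C * L2_norm M u"
  shows "bounded_operator M Q"
  using assms unfolding bounded_operator_def by blast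

lemma bounded_operator_cong:
  assumes "bounded_operator M Q" "\<And>u. u \<in> L2 M \<Longrightarrow> Q' u = Q u"
  shows "bounded_operator M Q'"
  using assms by (simp add: bounded_operator_def)

lemma bounded_operator_comp:
  assumes Q: "bounded_operator M Q" and R: "bounded_operator M R"
  shows "bounded_operator M (\<lambda>u. Q (R u))"
proof -
  obtain C where C: "C \<ge> 0" "\<And>u. u \<in> L2 M \<Longrightarrow> L2_norm M (Q u) \<le> C * L2_norm M u"
    using bounded_operator_bound[OF Q] by blast
  obtain D where D: "D \<ge> 0" "\<And>u. u \<in> L2 M \<Longrightarrow> L2_norm M (R u) \<le> D * L2_norm M u"
    using bounded_operator_bound[OF R] by blast
  have "L2_norm M (Q (R u)) \<le> (C * D) * L2_norm M u" if "u \<in> L2 M" for u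
    using C(2)[OF bounded_operator_in[OF R that]] mult_left_mono[OF D(2)[OF that] C(1)]
    by (simp add: mult.assoc)
  then show ?thesis
    by (intro bounded_operatorI)
      (simp_all add: Q R bounded_operator_in bounded_operator_add bounded_operator_scale)
qed

lemma bounded_operator_id: "bounded_operator M (\<lambda>u. u)"
  by (rule bounded_operatorI[where C=1]) auto

text \<open>This is z - Q, whose invertibility decides membership of z in the spectrum. With Q =
  \<Pi> and z = 1 it also covers centring.\<close>

lemma bounded_operator_resolvent:
  assumes Q: "bounded_operator M Q"
  shows "bounded_operator M (\<lambda>u. L2_diff M (L2_scale M z u) (Q u))"
proof -
  obtain C where C: "C \<ge> 0" "\<And>u. u \<in> L2 M \<Longrightarrow> L2_norm M (Q u) \<le> C * L2_norm M u"
    using bounded_operator_bound[OF Q] by blast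
  note QI = bounded_operator_in[OF Q]
  show ?thesis
  proof (rule bounded_operatorI[where C="cmod z + C"])
    fix u v assume u [simp]: "u \<in> L2 M" and v [simp]: "v \<in> L2 M"
    have "AE x in M. rep (L2_diff M (L2_scale M z (L2_add M u v)) (L2_add M (Q u) (Q v))) x =
         rep (L2_add M (L2_diff M (L2_scale M z u) (Q u)) (L2_diff M (L2_scale M z v) (Q v))) x"
      using rep_L2_diff[of "L2_scale M z (L2_add M u v)" M "L2_add M (Q u) (Q v)", OF L2_scale_in[OF L2_add_in[OF u v]] L2_add_in[OF QI[OF u] QI[OF v]]]
        rep_L2_scale[OF L2_add_in[OF u v], of z] rep_L2_add[OF u v] rep_L2_add[OF QI[OF u] QI[OF v]]
        rep_L2_add[OF L2_diff_in[OF L2_scale_in[OF u, of z] QI[OF u]] L2_diff_in[OF L2_scale_in[OF v, of z] QI[OF v]]]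
        rep_L2_diff[OF L2_scale_in[OF u, of z] QI[OF u]] rep_L2_diff[OF L2_scale_in[OF v, of z] QI[OF v]]
        rep_L2_scale[OF u, of z] rep_L2_scale[OF v, of z]
      by eventually_elim (simp add: distrib_left)
    then show "L2_diff M (L2_scale M z (L2_add M u v)) (Q (L2_add M u v)) =
        L2_add M (L2_diff M (L2_scale M z u) (Q u)) (L2_diff M (L2_scale M z v) (Q v))"
      by (simp add: bounded_operator_add[OF Q] QI L2_eq_iff[of _ M])
  next
    fix c u assume u [simp]: "u \<in> L2 M"
    have "L2_scale M z (L2_scale M c u) = L2_scale M c (L2_scale M z u)"
      using rep_L2_scale[OF u, of c] rep_L2_scale[OF u, of z] rep_L2_scale[OF L2_scale_in[OF u, of c], of z]
        rep_L2_scale[OF L2_scale_in[OF u, of z], of c]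
      by (intro L2_eqI[of _ M]) auto
    then show "L2_diff M (L2_scale M z (L2_scale M c u)) (Q (L2_scale M c u)) =
        L2_scale M c (L2_diff M (L2_scale M z u) (Q u))"
      by (simp add: bounded_operator_scale[OF Q] QI L2_scale_diff)
  next
    fix u assume u [simp]: "u \<in> L2 M"
    have "L2_norm M (L2_diff M (L2_scale M z u) (Q u)) \<le> cmod z * L2_norm M u + L2_norm M (Q u)"
      using L2_norm_triangle[of "L2_scale M z u" M "L2_scale M (-1) (Q u)"] QI[OF u]
      by (simp add: L2_diff_conv_add L2_norm_scale)
    then show "L2_norm M (L2_diff M (L2_scale M z u) (Q u)) \<le> (cmod z + C) * L2_norm M u"
      using C(2)[OF u] by (simp add: distrib_right)
  qed (simp add: QI)
qed

lemma L2_scale_1 [simp]: "u \<in> L2 M \<Longrightarrow> L2_scale M 1 u = u"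
  using rep_L2_scale[of u M 1] by (intro L2_eqI[of _ M]) auto

lemma L2_norm_triangle3:
  "u \<in> L2 M \<Longrightarrow> v \<in> L2 M \<Longrightarrow> w \<in> L2 M \<Longrightarrow>
    L2_norm M (L2_diff M u w) \<le> L2_norm M (L2_diff M u v) + L2_norm M (L2_diff M v w)"
  by (rule Metric_space.triangle[OF Metric_space_L2])

lemma L2_norm_triangle_diff:
  assumes "u \<in> L2 M" "v \<in> L2 M"
  shows "L2_norm M u \<le> L2_norm M v + L2_norm M (L2_diff M u v)"
  using Metric_space.triangle[OF Metric_space_L2, of u M v "L2_zero M"] assms by simp

lemma L2_diff_eq_iff_add:
  assumes u: "u \<in> L2 M" and v: "v \<in> L2 M" and w: "w \<in> L2 M"
  shows "L2_diff M w v = u \<longleftrightarrow> w = L2_add M u v"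
proof -
  have "L2_diff M w v = u \<longleftrightarrow> (AE x in M. rep w x - rep v x = rep u x)"
    using rep_L2_diff[OF w v] by (subst L2_eq_iff[of _ M]) (auto simp: u v w)
  moreover have "w = L2_add M u v \<longleftrightarrow> (AE x in M. rep w x = rep u x + rep v x)"
    using rep_L2_add[OF u v] by (subst L2_eq_iff[of _ M]) (auto simp: u v w)
  ultimately show ?thesis by (simp add: diff_eq_eq)
qed

text \<open>The Neumann series is replaced by Banach's fixed point theorem for
  \<open>v \<mapsto> (u + Q v) / z\<close>.\<close>

lemma (in prob_space) cmod_le_if_in_spectrum:
  assumes Q: "bounded_operator M Q"
    and q: "\<And>u. u \<in> L2 M \<Longrightarrow> L2_norm M (Q u) \<le> q * L2_norm M u" and "q \<ge> 0"
    and z: "z \<in> spectrum M Q"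
  shows "cmod z \<le> q"
proof (rule ccontr)
  assume "\<not> cmod z \<le> q"
  then have zq: "cmod z > q" by simp
  with \<open>q \<ge> 0\<close> have "z \<noteq> 0" by auto
  define L where "L u = L2_diff M (L2_scale M z u) (Q u)" for u
  have L: "bounded_operator M L"
    unfolding L_def by (rule bounded_operator_resolvent[OF Q])
  note QI = bounded_operator_in[OF Q] and LI = bounded_operator_in[OF L]
  \<comment> \<open>This lower bound gives both the injectivity of z - Q and, at the end, the bound
    on its inverse.\<close>
  have low: "(cmod z - q) * L2_norm M u \<le> L2_norm M (L u)" if u: "u \<in> L2 M" for u
    using L2_norm_triangle_diff[of "L2_scale M z u" M "Q u"] QI[OF u] q[OF u] u
    by (simp add: L_def L2_norm_scale left_diff_distrib)
  have inj: "u = v" if "u \<in> L2 M" "v \<in> L2 M" "L u = L v" for u v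
  proof -
    have "L (L2_diff M u v) = L2_zero M"
      using that by (simp add: bounded_operator_diff[OF L] L2_diff_self LI)
    with low[of "L2_diff M u v"] that have "(cmod z - q) * L2_norm M (L2_diff M u v) \<le> 0"
      by simp
    with zq have "L2_norm M (L2_diff M u v) = 0"
      by (simp add: mult_le_0_iff antisym)
    with that show ?thesis by (simp add: L2_norm_eq_0_iff L2_diff_eq_zero_iff)
  qed
  have ex: "\<exists>v\<in>L2 M. L v = u" if u: "u \<in> L2 M" for u
  proof -
    interpret LM: Metric_space "L2 M" "\<lambda>u v. L2_norm M (L2_diff M u v)"
      by (rule Metric_space_L2)
    define \<phi> where "\<phi> v = L2_scale M (1/z) (L2_add M u (Q v))" for v
    have "L2_norm M (L2_diff M (\<phi> v) (\<phi> w)) \<le> q / cmod z * L2_norm M (L2_diff M v w)"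
      if v: "v \<in> L2 M" and w: "w \<in> L2 M" for v w
    proof -
      \<comment> \<open>The summand u cancels, so \<phi> contracts distances by the factor q /
        |z|.\<close>
      have "L2_diff M (L2_add M u (Q v)) (L2_add M u (Q w)) = L2_diff M (Q v) (Q w)"
        using rep_L2_add[OF u QI[OF v]] rep_L2_add[OF u QI[OF w]] rep_L2_diff[OF QI[OF v] QI[OF w]]
          rep_L2_diff[OF L2_add_in[OF u QI[OF v]] L2_add_in[OF u QI[OF w]]]
        by (intro L2_eqI[of _ M]) (auto simp: u v w QI)
      then have "L2_diff M (\<phi> v) (\<phi> w) = L2_scale M (1/z) (Q (L2_diff M v w))"
        unfolding \<phi>_def using u v w by (simp add: L2_scale_diff[symmetric] QI bounded_operator_diff[OF Q])
      then have "L2_norm M (L2_diff M (\<phi> v) (\<phi> w)) = L2_norm M (Q (L2_diff M v w)) / cmod z"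
        using v w by (simp add: L2_norm_scale QI norm_divide)
      also have "\<dots> \<le> q * L2_norm M (L2_diff M v w) / cmod z"
        by (intro divide_right_mono q) (auto simp: v w)
      finally show ?thesis by simp
    qed
    moreover have "q / cmod z < 1" using zq \<open>q \<ge> 0\<close> by (subst divide_less_eq_1_pos) linarith+
    moreover have "\<phi> \<in> L2 M \<rightarrow> L2 M" using u QI by (auto simp: \<phi>_def)
    moreover have "L2 M \<noteq> {}" using u by auto
    ultimately obtain v where v: "v \<in> L2 M" "\<phi> v = v"
      using LM.Banach_fixedpoint_thm[OF mcomplete_L2] by blast
    have "L2_scale M z v = L2_scale M z (\<phi> v)" using v by simp
    also have "\<dots> = L2_add M u (Q v)"
      using rep_L2_scale[OF L2_add_in[OF u QI[OF v(1)]], of "1/z"]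
        rep_L2_scale[OF L2_scale_in[OF L2_add_in[OF u QI[OF v(1)]], of "1/z"], of z]
      by (intro L2_eqI[of _ M]) (auto simp: \<phi>_def u v(1) QI \<open>z \<noteq> 0\<close>)
    finally have "L v = u"
      using u v(1) by (simp add: L_def L2_diff_eq_iff_add QI)
    with v(1) show ?thesis by blast
  qed
  define R where "R u = (THE v. v \<in> L2 M \<and> L v = u)" for u
  have R: "R u \<in> L2 M \<and> L (R u) = u" if u: "u \<in> L2 M" for u
    unfolding R_def by (rule theI') (use ex[OF u] inj in blast)
  have RL: "R (L u) = u" if u: "u \<in> L2 M" for u
    using inj R[OF LI[OF u]] u by blast
  have "bounded_operator M R"
  proof (rule bounded_operatorI[where C="1 / (cmod z - q)"])
    fix u assume u: "u \<in> L2 M"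
    show "R u \<in> L2 M" using R u by blast
    show "L2_norm M (R u) \<le> 1 / (cmod z - q) * L2_norm M u"
      using low[of "R u"] R[OF u] zq by (simp add: field_simps)
    fix c
    \<comment> \<open>Linearity of the inverse: both sides have the same image under the injective
      linear map L.\<close>
    show "R (L2_scale M c u) = L2_scale M c (R u)"
      using inj[of "R (L2_scale M c u)" "L2_scale M c (R u)"] R u
      by (simp add: bounded_operator_scale[OF L])
  next
    fix u v assume "u \<in> L2 M" "v \<in> L2 M"
    then show "R (L2_add M u v) = L2_add M (R u) (R v)"
      using inj[of "R (L2_add M u v)" "L2_add M (R u) (R v)"] R
      by (simp add: bounded_operator_add[OF L])
  qed
  with R RL have "z \<notin> spectrum M Q"
    by (auto simp: spectrum_def L_def intro!: exI[of _ R])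
  with z show False by blast
qed

section \<open>Spectral radius and lower bounds\<close>

lemma not_in_spectrum_bound:
  assumes "z \<notin> spectrum M Q" "bounded_operator M Q"
  obtains C where "C \<ge> 0" "\<And>u. u \<in> L2 M \<Longrightarrow>
    L2_norm M u \<le> C * L2_norm M (L2_diff M (L2_scale M z u) (Q u))"
proof -
  obtain R where R: "bounded_operator M R"
    and inv: "\<And>u. u \<in> L2 M \<Longrightarrow> R (L2_diff M (L2_scale M z u) (Q u)) = u"
    using assms(1) by (auto simp: spectrum_def)
  obtain C where C: "C \<ge> 0" "\<And>u. u \<in> L2 M \<Longrightarrow> L2_norm M (R u) \<le> C * L2_norm M u"
    using bounded_operator_bound[OF R] by blast
  show ?thesis
  proof (rule that[OF C(1)])
    fix u assume u: "u \<in> L2 M"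
    then have "L2_diff M (L2_scale M z u) (Q u) \<in> L2 M"
      using assms(2) by (simp add: bounded_operator_in)
    from C(2)[OF this] show "L2_norm M u \<le> C * L2_norm M (L2_diff M (L2_scale M z u) (Q u))"
      by (simp add: inv[OF u])
  qed
qed

text \<open>A bounded inverse of 0 - Q would bound the norm of u by a multiple of the norm of Q u,
  which vanishes.\<close>

lemma kernel_imp_0_in_spectrum:
  assumes Q: "bounded_operator M Q" and u: "u \<in> L2 M" "u \<noteq> L2_zero M" "Q u = L2_zero M"
  shows "0 \<in> spectrum M Q"
proof (rule ccontr)
  assume "0 \<notin> spectrum M Q"
  then obtain C where "L2_norm M u \<le> C * L2_norm M (L2_diff M (L2_scale M 0 u) (Q u))"
    using not_in_spectrum_bound[OF _ Q] u(1) by metis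
  also have "L2_norm M (L2_diff M (L2_scale M 0 u) (Q u)) = 0"
    using u by (simp add: L2_norm_scale)
  finally show False using u L2_norm_nonneg[of M u] L2_norm_eq_0_iff[OF u(1)] by simp
qed

text \<open>The nonzero kernel vector is there to make the spectrum nonempty: a real supremum over
  the empty set would carry no information.\<close>

lemma (in prob_space) spectral_radius_le:
  assumes "bounded_operator M Q"
    and "\<And>u. u \<in> L2 M \<Longrightarrow> L2_norm M (Q u) \<le> q * L2_norm M u" and "q \<ge> 0"
    and "u \<in> L2 M" "u \<noteq> L2_zero M" "Q u = L2_zero M"
  shows "spectral_radius M Q \<le> q"
  unfolding spectral_radius_def
  using kernel_imp_0_in_spectrum[OF assms(1,4-6)] cmod_le_if_in_spectrum[OF assms(1-3)]
  by (intro cSUP_least) auto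

text \<open>The bound on Q also bounds the spectrum, so the supremum really dominates its members.
  Hence 1 lies outside the spectrum, and the inverse of 1 - Q supplies C.\<close>

lemma (in prob_space) spectral_radius_less_1_bound:
  assumes Q: "bounded_operator M Q" and "spectral_radius M Q < 1"
  obtains C where "C \<ge> 0" "\<And>u. u \<in> L2 M \<Longrightarrow> L2_norm M u \<le> C * L2_norm M (L2_diff M u (Q u))"
proof -
  obtain D where D: "D \<ge> 0" "\<And>u. u \<in> L2 M \<Longrightarrow> L2_norm M (Q u) \<le> D * L2_norm M u"
    using bounded_operator_bound[OF Q] by blast
  have "bdd_above (cmod ` spectrum M Q)"
    using cmod_le_if_in_spectrum[OF Q D(2,1)] by (intro bdd_aboveI[of _ D]) auto
  then have "cmod z < 1" if "z \<in> spectrum M Q" for z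
    using cSUP_upper[OF that, of cmod] assms(2) unfolding spectral_radius_def by linarith
  then have "1 \<notin> spectrum M Q" by force
  from not_in_spectrum_bound[OF this Q] that show ?thesis
    by (metis L2_scale_1)
qed

section \<open>The operator norm\<close>

lemma op_norm_le:
  assumes "\<And>u. u \<in> L2 M \<Longrightarrow> L2_norm M (Q u) \<le> q * L2_norm M u" "q \<ge> 0"
  shows "op_norm M Q \<le> q"
  unfolding op_norm_def
proof (rule cSUP_least)
  show "{u \<in> L2 M. L2_norm M u \<le> 1} \<noteq> {}"
    by (auto intro!: exI[of _ "L2_zero M"])
  show "L2_norm M (Q u) \<le> q" if "u \<in> {u \<in> L2 M. L2_norm M u \<le> 1}" for u
    using that assms(1)[of u] mult_left_mono[of "L2_norm M u" 1 q] assms(2) by auto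
qed

lemma L2_norm_le_op_norm:
  assumes Q: "bounded_operator M Q" and u: "u \<in> L2 M"
  shows "L2_norm M (Q u) \<le> op_norm M Q * L2_norm M u"
proof (cases "u = L2_zero M")
  case True
  then show ?thesis by (simp add: bounded_operator_zero[OF Q])
next
  case False
  define a where "a = L2_norm M u"
  have a: "a > 0"
    using False L2_norm_eq_0_iff[OF u] L2_norm_nonneg[of M u] unfolding a_def by linarith
  obtain C where C: "C \<ge> 0" "\<And>u. u \<in> L2 M \<Longrightarrow> L2_norm M (Q u) \<le> C * L2_norm M u"
    using bounded_operator_bound[OF Q] by blast
  have bdd: "bdd_above ((\<lambda>u. L2_norm M (Q u)) ` {u \<in> L2 M. L2_norm M u \<le> 1})"
  proof (rule bdd_aboveI2)
    show "L2_norm M (Q v) \<le> C" if "v \<in> {u \<in> L2 M. L2_norm M u \<le> 1}" for v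
      using that C(2)[of v] mult_left_mono[of "L2_norm M v" 1 C] C(1) by auto
  qed
  \<comment> \<open>Normalising u places it in the unit ball over which \<open>op_norm\<close> takes
    its supremum.\<close>
  have "L2_scale M (1/a) u \<in> {u \<in> L2 M. L2_norm M u \<le> 1}"
    using u a by (simp add: L2_norm_scale a_def[symmetric] norm_divide)
  from cSUP_upper[OF this bdd] have "L2_norm M (Q (L2_scale M (1/a) u)) \<le> op_norm M Q"
    by (simp add: op_norm_def)
  then show ?thesis
    using u a by (simp add: bounded_operator_scale[OF Q] bounded_operator_in[OF Q] L2_norm_scale
        norm_divide a_def[symmetric] field_simps)
qed

section \<open>Orthogonal projections\<close>

lemma L2_inner_cong:
  assumes "u \<in> L2 M" "v \<in> L2 M" "f \<in> borel_measurable M" "h \<in> borel_measurable M"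
    "AE x in M. rep u x = f x" "AE x in M. rep v x = h x"
  shows "L2_inner M u v = (LINT x|M. f x * cnj (h x))"
proof -
  note [measurable] = rep_L2_funs[OF assms(1)] rep_L2_funs[OF assms(2)] assms(3,4)
  show ?thesis
    unfolding L2_inner_def using assms(5,6) by (intro integral_cong_AE) auto
qed

lemma L2_inner_diff_left:
  assumes u: "u \<in> L2 M" and v: "v \<in> L2 M" and w: "w \<in> L2 M"
  shows "L2_inner M (L2_diff M u v) w = L2_inner M u w - L2_inner M v w"
proof -
  note [measurable] = rep_L2_funs[OF u] rep_L2_funs[OF v] rep_L2_funs[OF w]
  have "L2_inner M (L2_diff M u v) w = (LINT x|M. (rep u x - rep v x) * cnj (rep w x))"
    using u v w rep_L2_diff[OF u v] by (intro L2_inner_cong) auto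
  also have "\<dots> = L2_inner M u w - L2_inner M v w"
    unfolding L2_inner_def left_diff_distrib
    by (intro Bochner_Integration.integral_diff L2_funs_integrable_mult rep_L2_funs u v w)
  finally show ?thesis .
qed

lemma L2_inner_add_left:
  assumes u: "u \<in> L2 M" and v: "v \<in> L2 M" and w: "w \<in> L2 M"
  shows "L2_inner M (L2_add M u v) w = L2_inner M u w + L2_inner M v w"
proof -
  note [measurable] = rep_L2_funs[OF u] rep_L2_funs[OF v] rep_L2_funs[OF w]
  have "L2_inner M (L2_add M u v) w = (LINT x|M. (rep u x + rep v x) * cnj (rep w x))"
    using u v w rep_L2_add[OF u v] by (intro L2_inner_cong) auto
  also have "\<dots> = L2_inner M u w + L2_inner M v w"
    unfolding L2_inner_def distrib_right
    by (intro Bochner_Integration.integral_add L2_funs_integrable_mult rep_L2_funs u v w)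
  finally show ?thesis .
qed

lemma L2_inner_scale_left:
  assumes u: "u \<in> L2 M" and w: "w \<in> L2 M"
  shows "L2_inner M (L2_scale M c u) w = c * L2_inner M u w"
proof -
  note [measurable] = rep_L2_funs[OF u] rep_L2_funs[OF w]
  have "L2_inner M (L2_scale M c u) w = (LINT x|M. (c * rep u x) * cnj (rep w x))"
    using u w rep_L2_scale[OF u] by (intro L2_inner_cong) auto
  then show ?thesis
    unfolding L2_inner_def by (simp add: mult.assoc)
qed

lemma L2_inner_self: "L2_inner M u u = complex_of_real ((L2_norm M u)\<^sup>2)"
  unfolding L2_inner_def L2_norm_power2 complex_norm_square[symmetric]
  by (rule integral_complex_of_real)

lemma L2_norm_pythagoras:
  assumes u: "u \<in> L2 M" and v: "v \<in> L2 M" and orth: "L2_inner M u v = 0"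
  shows "(L2_norm M (L2_add M u v))\<^sup>2 = (L2_norm M u)\<^sup>2 + (L2_norm M v)\<^sup>2"
proof -
  note [measurable] = rep_L2_funs[OF u] rep_L2_funs[OF v]
  note int = L2_funs_integrable[OF rep_L2_funs[OF u]] L2_funs_integrable[OF rep_L2_funs[OF v]]
    L2_funs_integrable_mult[OF rep_L2_funs[OF u] rep_L2_funs[OF v]]
  have "(L2_norm M (L2_add M u v))\<^sup>2 = (LINT x|M. (cmod (rep u x + rep v x))\<^sup>2)"
    using u v rep_L2_add[OF u v] by (intro L2_norm_cong) auto
  also have "\<dots> = (LINT x|M. ((cmod (rep u x))\<^sup>2 + (cmod (rep v x))\<^sup>2) + 2 * Re (rep u x * cnj (rep v x)))"
    by (intro Bochner_Integration.integral_cong refl) (simp add: cmod_power2 power2_sum)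
  \<comment> \<open>The product rule for \<open>Re\<close> is kept out of the simplifier so that the
    cross term stays the real part of the inner product.\<close>
  also have "\<dots> = (L2_norm M u)\<^sup>2 + (L2_norm M v)\<^sup>2 + 2 * Re (L2_inner M u v)"
    using int(1,2) integrable_Re[OF int(3)] integral_Re[OF int(3)]
    unfolding L2_norm_power2 L2_inner_def by (simp del: times_complex.sel)
  finally show ?thesis using orth by simp
qed

text \<open>Orthogonal decomposition is made an axiom in place of closedness: conditional
  expectations will supply it directly, without a minimisation argument.\<close>

locale L2_complemented =
  fixes M :: "'x measure" and F :: "'x l2_class set"
  assumes F_subset: "F \<subseteq> L2 M"
    and F_add: "u \<in> F \<Longrightarrow> v \<in> F \<Longrightarrow> L2_add M u v \<in> F"
    and F_scale: "u \<in> F \<Longrightarrow> L2_scale M c u \<in> F"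
    and F_complement: "u \<in> L2 M \<Longrightarrow> \<exists>v\<in>F. \<forall>w\<in>F. L2_inner M (L2_diff M u v) w = 0"
begin

abbreviation P :: "'x l2_class \<Rightarrow> 'x l2_class" where
  "P \<equiv> orth_proj M F"

lemma F_L2 [simp]: "u \<in> F \<Longrightarrow> u \<in> L2 M"
  using F_subset by blast

lemma F_diff: "u \<in> F \<Longrightarrow> v \<in> F \<Longrightarrow> L2_diff M u v \<in> F"
  by (simp add: L2_diff_conv_add F_add F_scale)

text \<open>The difference of two candidates lies in F and is also a difference of two residuals
  orthogonal to F, so it is orthogonal to itself. This makes the \<open>THE\<close> in
  \<open>orth_proj\<close> well defined.\<close>

lemma projection_unique:
  assumes u: "u \<in> L2 M" and v: "v \<in> F" "\<forall>w\<in>F. L2_inner M (L2_diff M u v) w = 0"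
    and v': "v' \<in> F" "\<forall>w\<in>F. L2_inner M (L2_diff M u v') w = 0"
  shows "v = v'"
proof -
  have "L2_diff M v v' = L2_diff M (L2_diff M u v') (L2_diff M u v)"
    using u v v' by (simp add: L2_diff_diff_diff_left)
  then have "L2_inner M (L2_diff M v v') (L2_diff M v v') = 0"
    using u v v' F_diff[of v v']
    by (metis F_L2 L2_diff_in L2_inner_diff_left diff_self)
  then have "L2_norm M (L2_diff M v v') = 0"
    by (simp add: L2_inner_self)
  then show ?thesis
    using v v' by (simp add: L2_norm_eq_0_iff L2_diff_eq_zero_iff)
qed

lemma proj_eqI:
  assumes "u \<in> L2 M" "v \<in> F" "\<And>w. w \<in> F \<Longrightarrow> L2_inner M (L2_diff M u v) w = 0"
  shows "P u = v"
  unfolding orth_proj_def using assms projection_unique[OF assms(1)] by (intro the_equality) auto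

lemma proj_orthogonal:
  assumes "u \<in> L2 M"
  shows "P u \<in> F \<and> (\<forall>w\<in>F. L2_inner M (L2_diff M u (P u)) w = 0)"
proof -
  obtain v where v: "v \<in> F" "\<forall>w\<in>F. L2_inner M (L2_diff M u v) w = 0"
    using F_complement[OF assms] by blast
  then have "P u = v" by (intro proj_eqI[OF assms]) blast+
  with v show ?thesis by blast
qed

lemma proj_in_F: "u \<in> L2 M \<Longrightarrow> P u \<in> F"
  and proj_orth: "u \<in> L2 M \<Longrightarrow> w \<in> F \<Longrightarrow> L2_inner M (L2_diff M u (P u)) w = 0"
  using proj_orthogonal by blast+

lemma proj_in_L2 [simp]: "u \<in> L2 M \<Longrightarrow> P u \<in> L2 M"
  by (simp add: proj_in_F)

lemma proj_ident: "u \<in> F \<Longrightarrow> P u = u"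
  by (rule proj_eqI) (simp_all add: L2_inner_diff_left)

text \<open>The residual of u is orthogonal to P u - w, which lies in F. Taking w = 0 splits the
  norm of u; dropping the last term shows that P u is the nearest point.\<close>

lemma proj_pythagoras:
  assumes u: "u \<in> L2 M" and w: "w \<in> F"
  shows "(L2_norm M (L2_diff M u w))\<^sup>2
    = (L2_norm M (L2_diff M u (P u)))\<^sup>2 + (L2_norm M (L2_diff M (P u) w))\<^sup>2"
  using L2_norm_pythagoras[of "L2_diff M u (P u)" M "L2_diff M (P u) w"]
    proj_orth[OF u F_diff[OF proj_in_F[OF u] w]] u w
  by (simp add: L2_add_diff_diff)

lemma zero_in_F: "L2_zero M \<in> F"
proof -
  \<comment> \<open>The axioms provide some member of F only through the decomposition of a vector;
    the zero class is always at hand.\<close>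
  obtain v where v: "v \<in> F" using F_complement[OF L2_zero_in] by blast
  then have "L2_scale M 0 v = L2_zero M"
    using L2_norm_eq_0_iff[of "L2_scale M 0 v" M] by (simp add: L2_norm_scale)
  with F_scale[OF v, of 0] show ?thesis by simp
qed

lemma proj_norm_power2:
  assumes u: "u \<in> L2 M"
  shows "(L2_norm M u)\<^sup>2 = (L2_norm M (L2_diff M u (P u)))\<^sup>2 + (L2_norm M (P u))\<^sup>2"
  using proj_pythagoras[OF u zero_in_F] u by simp

lemma proj_nearest:
  assumes u: "u \<in> L2 M" and w: "w \<in> F"
  shows "L2_norm M (L2_diff M u (P u)) \<le> L2_norm M (L2_diff M u w)"
  by (rule power2_le_imp_le) (simp_all add: proj_pythagoras[OF u w])

lemma proj_norm_le:
  assumes u: "u \<in> L2 M"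
  shows "L2_norm M (P u) \<le> L2_norm M u"
  by (rule power2_le_imp_le) (simp_all only: proj_norm_power2[OF u] L2_norm_nonneg, simp)

text \<open>Linearity follows from uniqueness: the sum or multiple of projections satisfies the
  orthogonality that characterises the projection.\<close>

lemma bounded_operator_proj: "bounded_operator M P"
proof (rule bounded_operatorI[where C=1])
  fix u v assume u: "u \<in> L2 M" and v: "v \<in> L2 M"
  show "P (L2_add M u v) = L2_add M (P u) (P v)"
  proof (rule proj_eqI)
    fix w assume w: "w \<in> F"
    show "L2_inner M (L2_diff M (L2_add M u v) (L2_add M (P u) (P v))) w = 0"
      using proj_orth[OF u w] proj_orth[OF v w] u v w
      by (simp add: L2_inner_diff_left L2_inner_add_left)
  qed (use u v in \<open>auto simp: F_add proj_in_F\<close>)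
next
  fix c u assume u: "u \<in> L2 M"
  show "P (L2_scale M c u) = L2_scale M c (P u)"
  proof (rule proj_eqI)
    fix w assume w: "w \<in> F"
    show "L2_inner M (L2_diff M (L2_scale M c u) (L2_scale M c (P u))) w = 0"
      using proj_orth[OF u w] u w
      by (simp add: L2_inner_diff_left L2_inner_scale_left)
  qed (use u in \<open>auto simp: F_scale proj_in_F\<close>)
qed (simp_all add: proj_norm_le)

end

section \<open>Classes with an invariant representative\<close>

definition invariant_algebra :: "'x measure \<Rightarrow> ('x \<Rightarrow> 'x \<Rightarrow> bool) \<Rightarrow> 'x measure" where
  "invariant_algebra M R = sigma (space M) {A \<in> sets M. \<forall>x\<in>A. \<forall>y\<in>space M. R x y \<longrightarrow> y \<in> A}"

text \<open>Abstracts \<open>const_in\<close>: there R x y says that x and y agree outside I. With R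
  always true the invariant classes are the constants, the range of \<Pi>.\<close>

definition invariant_classes :: "'x measure \<Rightarrow> ('x \<Rightarrow> 'x \<Rightarrow> bool) \<Rightarrow> 'x l2_class set" where
  "invariant_classes M R =
    {u \<in> L2 M. \<exists>f\<in>u. \<forall>x\<in>space M. \<forall>y\<in>space M. R x y \<longrightarrow> f x = f y}"

lemma invariant_classesI:
  assumes "u \<in> L2 M" "f \<in> u" "\<forall>x\<in>space M. \<forall>y\<in>space M. R x y \<longrightarrow> f x = f y"
  shows "u \<in> invariant_classes M R"
  unfolding invariant_classes_def using assms by blast

lemma space_invariant_algebra [simp]: "space (invariant_algebra M R) = space M"
  by (simp add: invariant_algebra_def space_measure_of_conv)

text \<open>The saturated measurable sets already form a \<sigma>-algebra. Symmetry of R is what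
  closes them under complements.\<close>

lemma sets_invariant_algebra:
  assumes "symp R"
  shows "sets (invariant_algebra M R) = {A \<in> sets M. \<forall>x\<in>A. \<forall>y\<in>space M. R x y \<longrightarrow> y \<in> A}"
proof -
  have "sigma_algebra (space M) {A \<in> sets M. \<forall>x\<in>A. \<forall>y\<in>space M. R x y \<longrightarrow> y \<in> A}"
    unfolding sigma_algebra_iff2
  proof (intro conjI ballI allI impI)
    fix A assume A: "A \<in> {A \<in> sets M. \<forall>x\<in>A. \<forall>y\<in>space M. R x y \<longrightarrow> y \<in> A}"
    then have "A \<subseteq> space M" using sets.sets_into_space by blast
    then show "space M - A \<in> {A \<in> sets M. \<forall>x\<in>A. \<forall>y\<in>space M. R x y \<longrightarrow> y \<in> A}"
      using A sympD[OF assms] by blast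
  next
    fix A :: "nat \<Rightarrow> 'a set"
    assume "range A \<subseteq> {A \<in> sets M. \<forall>x\<in>A. \<forall>y\<in>space M. R x y \<longrightarrow> y \<in> A}"
    then show "(\<Union>i. A i) \<in> {A \<in> sets M. \<forall>x\<in>A. \<forall>y\<in>space M. R x y \<longrightarrow> y \<in> A}"
      by (auto simp: image_subset_iff)
  qed (use sets.sets_into_space in blast, simp)
  then show ?thesis
    by (simp add: invariant_algebra_def sigma_algebra.sets_measure_of_eq)
qed

lemma subalgebra_invariant_algebra:
  assumes "symp R"
  shows "subalgebra M (invariant_algebra M R)"
  by (auto simp: subalgebra_def sets_invariant_algebra[OF assms])

text \<open>Measurable functions have saturated level sets, singletons being Borel; conversely
  preimages under an invariant function are saturated. Invariance holds at every point, not just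
  almost everywhere.\<close>

lemma measurable_invariant_algebra_iff:
  fixes f :: "'x \<Rightarrow> complex"
  assumes R: "symp R"
  shows "f \<in> borel_measurable (invariant_algebra M R) \<longleftrightarrow>
    f \<in> borel_measurable M \<and> (\<forall>x\<in>space M. \<forall>y\<in>space M. R x y \<longrightarrow> f x = f y)"
proof (intro iffI conjI ballI impI)
  assume f: "f \<in> borel_measurable (invariant_algebra M R)"
  then show "f \<in> borel_measurable M"
    by (rule measurable_from_subalg[OF subalgebra_invariant_algebra[OF R]])
  fix x y assume x: "x \<in> space M" "y \<in> space M" "R x y"
  have "f -` {f x} \<inter> space M \<in> sets (invariant_algebra M R)"
    using measurable_sets[OF f, of "{f x}"] by simp
  then have "\<forall>x'\<in>f -` {f x} \<inter> space M. \<forall>y\<in>space M. R x' y \<longrightarrow> y \<in> f -` {f x} \<inter> space M"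
    unfolding sets_invariant_algebra[OF R] by blast
  with x have "y \<in> f -` {f x} \<inter> space M" by blast
  then show "f x = f y" by simp
next
  assume f: "f \<in> borel_measurable M \<and> (\<forall>x\<in>space M. \<forall>y\<in>space M. R x y \<longrightarrow> f x = f y)"
  show "f \<in> borel_measurable (invariant_algebra M R)"
  proof (rule measurableI)
    fix A :: "complex set" assume "A \<in> sets borel"
    then have "f -` A \<inter> space M \<in> sets M"
      using f measurable_sets by blast
    moreover have "y \<in> f -` A \<inter> space M" if "x \<in> f -` A \<inter> space M" "y \<in> space M" "R x y" for x y
    proof -
      have "f x = f y" using f that by blast
      with that show ?thesis by simp
    qed
    ultimately show "f -` A \<inter> space (invariant_algebra M R) \<in> sets (invariant_algebra M R)"
      unfolding sets_invariant_algebra[OF R] space_invariant_algebra by blast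
  qed simp
qed

lemma L2_class_self: "f \<in> L2_funs M \<Longrightarrow> f \<in> L2_class M f"
  by (simp add: L2_class_def L2_rel_def)

lemma rep_eq_AE:
  assumes "u \<in> L2 M" "f \<in> u"
  shows "AE x in M. rep u x = f x"
  using rep_L2_class[OF L2_mem_funs[OF assms]] L2_class_eq[OF assms] by simp

section \<open>Conditional expectations as orthogonal projections\<close>

lemma abs_mult_le_sum_power2: "\<bar>a * b\<bar> \<le> a\<^sup>2 + b\<^sup>2" for a b :: real
proof -
  have "2 * (a * b) \<le> a\<^sup>2 + b\<^sup>2" "- (2 * (a * b)) \<le> a\<^sup>2 + b\<^sup>2"
    using sum_squares_bound[of a b] sum_squares_bound[of a "-b"] by (simp_all add: mult.assoc)
  then show ?thesis unfolding abs_le_iff by linarith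
qed

lemma integrable_mult_of_power2:
  fixes f h :: "'x \<Rightarrow> real"
  assumes [measurable]: "f \<in> borel_measurable M" "h \<in> borel_measurable M"
    and "integrable M (\<lambda>x. (f x)\<^sup>2)" "integrable M (\<lambda>x. (h x)\<^sup>2)"
  shows "integrable M (\<lambda>x. f x * h x)"
proof (rule Bochner_Integration.integrable_bound)
  show "integrable M (\<lambda>x. (f x)\<^sup>2 + (h x)\<^sup>2)"
    using assms by (intro Bochner_Integration.integrable_add)
  show "AE x in M. norm (f x * h x) \<le> norm ((f x)\<^sup>2 + (h x)\<^sup>2)"
    using abs_mult_le_sum_power2 by (intro AE_I2) (simp only: real_norm_def abs_of_nonneg sum_power2_ge_zero)
qed simp

text \<open>Conditional Jensen inequality for the square: the squared conditional expectation is
  dominated by that of the square.\<close>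

lemma (in finite_measure_subalgebra) integrable_real_cond_exp_power2:
  assumes [measurable]: "f \<in> borel_measurable M" and f2: "integrable M (\<lambda>x. (f x)\<^sup>2)"
  shows "integrable M (\<lambda>x. (real_cond_exp M F f x)\<^sup>2)"
proof -
  \<comment> \<open>The factor 1 is square-integrable on a finite measure space, so f itself is
    integrable, as Jensen's inequality requires.\<close>
  have "integrable M (\<lambda>x. f x * 1)"
    by (rule integrable_mult_of_power2[OF _ _ f2]) auto
  then have "AE x in M. (real_cond_exp M F f x)\<^sup>2 \<le> real_cond_exp M F (\<lambda>x. (f x)\<^sup>2) x"
    by (intro real_cond_exp_jensens_inequality(2)[where I=UNIV and q="\<lambda>x. x\<^sup>2"])
      (use f2 convex_power2 in auto)
  then show ?thesis
    by (intro Bochner_Integration.integrable_bound[OF real_cond_exp_int(1)[OF f2]]) auto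
qed

text \<open>Linear closure comes from combining invariant representatives. The orthogonal
  decomposition is conditional expectation given the invariant \<sigma>-algebra, formed separately
  for real and imaginary parts.\<close>

lemma (in prob_space) L2_complemented_invariant_classes:
  assumes R: "symp R"
  shows "L2_complemented M (invariant_classes M R)"
proof
  show "invariant_classes M R \<subseteq> L2 M"
    by (auto simp: invariant_classes_def)
next
  fix u v assume "u \<in> invariant_classes M R" "v \<in> invariant_classes M R"
  then obtain f h where u: "u \<in> L2 M" and v: "v \<in> L2 M" and f: "f \<in> u" and h: "h \<in> v"
    and inv: "\<forall>x\<in>space M. \<forall>y\<in>space M. R x y \<longrightarrow> f x = f y"
      "\<forall>x\<in>space M. \<forall>y\<in>space M. R x y \<longrightarrow> h x = h y"
    by (auto simp: invariant_classes_def)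
  have fh: "(\<lambda>x. f x + h x) \<in> L2_funs M"
    using u v f h by (intro L2_funs_add L2_mem_funs)
  \<comment> \<open>\<open>L2_add\<close> is computed from the arbitrary \<open>rep\<close>; the
    same class has to be exhibited through the invariant members f and h.\<close>
  have "L2_add M u v = L2_class M (\<lambda>x. f x + h x)"
    using rep_L2_add[OF u v] rep_eq_AE[OF u f] rep_eq_AE[OF v h] rep_L2_class[OF fh]
    by (intro L2_eqI[of _ M]) (auto simp: u v L2_class_in_L2 fh)
  then have "(\<lambda>x. f x + h x) \<in> L2_add M u v"
    using L2_class_self[OF fh] by simp
  moreover have "\<forall>x\<in>space M. \<forall>y\<in>space M. R x y \<longrightarrow> f x + h x = f y + h y"
    using inv by metis
  ultimately show "L2_add M u v \<in> invariant_classes M R"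
    by (rule invariant_classesI[OF L2_add_in[OF u v]])
next
  fix u c assume "u \<in> invariant_classes M R"
  then obtain f where u: "u \<in> L2 M" and f: "f \<in> u"
    and inv: "\<forall>x\<in>space M. \<forall>y\<in>space M. R x y \<longrightarrow> f x = f y"
    by (auto simp: invariant_classes_def)
  have cf: "(\<lambda>x. c * f x) \<in> L2_funs M"
    using u f by (intro L2_funs_scale L2_mem_funs)
  have "L2_scale M c u = L2_class M (\<lambda>x. c * f x)"
    using rep_L2_scale[OF u, of c] rep_eq_AE[OF u f] rep_L2_class[OF cf]
    by (intro L2_eqI[of _ M]) (auto simp: u L2_class_in_L2 cf)
  then have "(\<lambda>x. c * f x) \<in> L2_scale M c u"
    using L2_class_self[OF cf] by simp
  moreover have "\<forall>x\<in>space M. \<forall>y\<in>space M. R x y \<longrightarrow> c * f x = c * f y"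
    using inv by (intro ballI impI arg_cong[where f="\<lambda>t. c * t"]) blast
  ultimately show "L2_scale M c u \<in> invariant_classes M R"
    by (rule invariant_classesI[OF L2_scale_in[OF u]])
next
  fix u assume u: "u \<in> L2 M"
  define G where "G = invariant_algebra M R"
  interpret finite_measure_subalgebra M G
    by unfold_locales (simp add: G_def subalgebra_invariant_algebra[OF R])
  define f1 f2 where "f1 = (\<lambda>x. Re (rep u x))" and "f2 = (\<lambda>x. Im (rep u x))"
  note [measurable] = rep_L2_funs[OF u]
  have meas [measurable]: "f1 \<in> borel_measurable M" "f2 \<in> borel_measurable M"
    by (auto simp: f1_def f2_def)
  have sq: "integrable M (\<lambda>x. (f1 x)\<^sup>2)" "integrable M (\<lambda>x. (f2 x)\<^sup>2)"
    by (rule Bochner_Integration.integrable_bound[OF L2_funs_integrable[OF rep_L2_funs[OF u]]];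
        simp add: f1_def f2_def cmod_power2)+
  define e1 e2 where "e1 = real_cond_exp M G f1" and "e2 = real_cond_exp M G f2"
  have eG [measurable]: "e1 \<in> borel_measurable G" "e2 \<in> borel_measurable G"
    by (auto simp: e1_def e2_def)
  have eM [measurable]: "e1 \<in> borel_measurable M" "e2 \<in> borel_measurable M"
    by (auto simp: e1_def e2_def)
  have esq: "integrable M (\<lambda>x. (e1 x)\<^sup>2)" "integrable M (\<lambda>x. (e2 x)\<^sup>2)"
    unfolding e1_def e2_def by (intro integrable_real_cond_exp_power2 meas sq)+
  define e where "e x = Complex (e1 x) (e2 x)" for x
  have e_alt: "e = (\<lambda>x. complex_of_real (e1 x) + \<i> * complex_of_real (e2 x))"
    by (auto simp: e_def Complex_eq)
  have eL: "e \<in> L2_funs M"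
    unfolding L2_funs_def using esq by (simp add: cmod_power2 e_alt)
  \<comment> \<open>\<open>real_cond_exp\<close> is measurable for the subalgebra itself, so e is
    invariant at every point, as a witness in \<open>invariant_classes\<close> must be.\<close>
  have "e \<in> borel_measurable G"
    unfolding e_alt by measurable
  then have inv: "\<forall>x\<in>space M. \<forall>y\<in>space M. R x y \<longrightarrow> e x = e y"
    by (simp add: G_def measurable_invariant_algebra_iff[OF R])
  define v where "v = L2_class M e"
  have v: "v \<in> L2 M" by (simp add: v_def L2_class_in_L2 eL)
  have "v \<in> invariant_classes M R"
    by (rule invariant_classesI[OF v _ inv]) (simp add: v_def L2_class_self eL)
  moreover have "L2_inner M (L2_diff M u v) w = 0" if winv: "w \<in> invariant_classes M R" for w
  proof -
    obtain h where w: "w \<in> L2 M" and h: "h \<in> w" and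
      hinv: "\<forall>x\<in>space M. \<forall>y\<in>space M. R x y \<longrightarrow> h x = h y"
      using winv by (auto simp: invariant_classes_def)
    note hL = L2_mem_funs[OF w h]
    note [measurable] = hL eL
    have hG [measurable]: "h \<in> borel_measurable G"
      using hinv by (simp add: G_def measurable_invariant_algebra_iff[OF R])
    define a b where "a = (\<lambda>x. Re (h x))" and "b = (\<lambda>x. Im (h x))"
    have ab [measurable]: "a \<in> borel_measurable G" "b \<in> borel_measurable G"
      by (auto simp: a_def b_def)
    have abM [measurable]: "a \<in> borel_measurable M" "b \<in> borel_measurable M"
      by (auto simp: a_def b_def)
    have absq: "integrable M (\<lambda>x. (a x)\<^sup>2)" "integrable M (\<lambda>x. (b x)\<^sup>2)"
      by (rule Bochner_Integration.integrable_bound[OF L2_funs_integrable[OF hL]];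
          simp add: a_def b_def cmod_power2)+
    note im = integrable_mult_of_power2
    note if1 = im[OF abM(1) meas(1) absq(1) sq(1)] im[OF abM(2) meas(1) absq(2) sq(1)]
    note if2 = im[OF abM(1) meas(2) absq(1) sq(2)] im[OF abM(2) meas(2) absq(2) sq(2)]
    note ie1 = im[OF abM(1) eM(1) absq(1) esq(1)] im[OF abM(2) eM(1) absq(2) esq(1)]
    note ie2 = im[OF abM(1) eM(2) absq(1) esq(2)] im[OF abM(2) eM(2) absq(2) esq(2)]
    \<comment> \<open>Defining property of conditional expectation, tested against the G-measurable
      functions a and b.\<close>
    have eq: "(LINT x|M. a x * e1 x) = (LINT x|M. a x * f1 x)" "(LINT x|M. b x * e1 x) = (LINT x|M. b x * f1 x)"
       "(LINT x|M. a x * e2 x) = (LINT x|M. a x * f2 x)" "(LINT x|M. b x * e2 x) = (LINT x|M. b x * f2 x)"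
      unfolding e1_def e2_def by (intro real_cond_exp_intg(2) if1 if2 ab meas)+
    note ue = L2_funs_integrable_mult[OF rep_L2_funs[OF u] hL] L2_funs_integrable_mult[OF eL hL]
    \<comment> \<open>With u = f1 + i f2 and h = a + i b, the integrand has real part a f1 + b f2
      and imaginary part a f2 - b f1, so the four real identities suffice.\<close>
    have "(LINT x|M. rep u x * cnj (h x)) = (LINT x|M. e x * cnj (h x))"
    proof (rule complex_eqI)
      have "Re (LINT x|M. rep u x * cnj (h x)) = (LINT x|M. a x * f1 x + b x * f2 x)"
        unfolding integral_Re[OF ue(1), symmetric]
        by (intro Bochner_Integration.integral_cong) (auto simp: a_def b_def f1_def f2_def)
      also have "\<dots> = (LINT x|M. a x * e1 x + b x * e2 x)"
        using if1 if2 ie1 ie2 eq by simp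
      also have "\<dots> = Re (LINT x|M. e x * cnj (h x))"
        unfolding integral_Re[OF ue(2), symmetric]
        by (intro Bochner_Integration.integral_cong) (auto simp: a_def b_def e_def)
      finally show "Re (LINT x|M. rep u x * cnj (h x)) = Re (LINT x|M. e x * cnj (h x))" .
      have "Im (LINT x|M. rep u x * cnj (h x)) = (LINT x|M. a x * f2 x - b x * f1 x)"
        unfolding integral_Im[OF ue(1), symmetric]
        by (intro Bochner_Integration.integral_cong) (auto simp: a_def b_def f1_def f2_def)
      also have "\<dots> = (LINT x|M. a x * e2 x - b x * e1 x)"
        using if1 if2 ie1 ie2 eq by simp
      also have "\<dots> = Im (LINT x|M. e x * cnj (h x))"
        unfolding integral_Im[OF ue(2), symmetric]
        by (intro Bochner_Integration.integral_cong) (auto simp: a_def b_def e_def)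
      finally show "Im (LINT x|M. rep u x * cnj (h x)) = Im (LINT x|M. e x * cnj (h x))" .
    qed
    moreover have "L2_inner M u w = (LINT x|M. rep u x * cnj (h x))"
      by (intro L2_inner_cong u w rep_eq_AE[OF w h]) auto
    moreover have "L2_inner M v w = (LINT x|M. e x * cnj (h x))"
      using rep_L2_class[OF eL] by (intro L2_inner_cong v w rep_eq_AE[OF w h]) (auto simp: v_def)
    ultimately show ?thesis
      using u v w by (simp add: L2_inner_diff_left)
  qed
  ultimately show "\<exists>v\<in>invariant_classes M R. \<forall>w\<in>invariant_classes M R. L2_inner M (L2_diff M u v) w = 0"
    by blast
qed

section \<open>The projection onto the constants\<close>

lemma (in finite_measure) L2_funs_const: "(\<lambda>_. c) \<in> L2_funs M"
  by (simp add: L2_funs_def)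

lemma (in prob_space) mean_op_in: "mean_op M u \<in> invariant_classes M R"
  unfolding mean_op_def
  by (rule invariant_classesI[OF L2_class_in_L2 L2_class_self]) (auto simp: L2_funs_const)

text \<open>Makes the general facts on projections available for \<Pi>. Subtracting the mean leaves
  a function orthogonal to every constant.\<close>

lemma (in prob_space) mean_op_eq_proj:
  assumes u: "u \<in> L2 M"
  shows "mean_op M u = orth_proj M (invariant_classes M (\<lambda>_ _. True)) u"
proof -
  interpret C: L2_complemented M "invariant_classes M (\<lambda>_ _. True)"
    by (rule L2_complemented_invariant_classes) (simp add: symp_def)
  have "C.P u = mean_op M u"
  proof (rule C.proj_eqI[OF u mean_op_in])
    fix w assume w: "w \<in> invariant_classes M (\<lambda>_ _. True)"
    then obtain f where f: "f \<in> w" "\<forall>x\<in>space M. \<forall>y\<in>space M. True \<longrightarrow> f x = f y"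
      unfolding invariant_classes_def by blast
    have wL: "w \<in> L2 M" using w by simp
    \<comment> \<open>The constant value of f is read off at some point; a probability space is not
      empty.\<close>
    obtain x0 where "x0 \<in> space M" using not_empty by blast
    then have "AE x in M. f x = f x0" using f(2) by (intro AE_I2) blast
    with rep_eq_AE[OF wL f(1)] have c: "AE x in M. rep w x = f x0" by eventually_elim simp
    note [measurable] = rep_L2_funs[OF u]
    have "L2_inner M u w = (LINT x|M. rep u x * cnj (f x0))"
      using c by (intro L2_inner_cong u wL) auto
    also have "\<dots> = (LINT x|M. rep u x) * cnj (f x0)" by simp
    \<comment> \<open>Total mass 1 allows the number to be written as the integral of a constant,
      which is an inner product with the class of the mean.\<close>
    also have "\<dots> = (LINT y|M. (LINT x|M. rep u x) * cnj (f x0))" by (simp add: prob_space)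
    also have "\<dots> = L2_inner M (mean_op M u) w"
      using c rep_L2_class[OF L2_funs_const]
      by (intro L2_inner_cong[symmetric] wL) (auto simp: mean_op_def L2_class_in_L2 L2_funs_const)
    finally show "L2_inner M (L2_diff M u (mean_op M u)) w = 0"
      using u wL mean_op_in[of u] by (simp add: L2_inner_diff_left mean_op_def L2_class_in_L2 L2_funs_const)
  qed
  then show ?thesis by simp
qed

section \<open>Centring, and operators that fix the constants\<close>

context prob_space
begin

interpretation C: L2_complemented M "invariant_classes M (\<lambda>_ _. True)"
  by (rule L2_complemented_invariant_classes) (simp add: symp_def)

lemma mean_op_in_L2 [simp]: "mean_op M u \<in> L2 M"
  using mean_op_in[of u "\<lambda>_ _. True"] by (rule C.F_L2)

lemma bounded_operator_mean: "bounded_operator M (mean_op M)"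
  by (rule bounded_operator_cong[OF C.bounded_operator_proj mean_op_eq_proj])

lemma mean_op_idem: "mean_op M (mean_op M u) = mean_op M u"
  using C.proj_ident[OF mean_op_in] by (simp add: mean_op_eq_proj[of "mean_op M u"])

definition centre :: "'a l2_class \<Rightarrow> 'a l2_class" where
  "centre u = L2_diff M u (mean_op M u)"

lemma centre_in_L2 [simp]: "u \<in> L2 M \<Longrightarrow> centre u \<in> L2 M"
  by (simp add: centre_def)

lemma mean_op_centre: "u \<in> L2 M \<Longrightarrow> mean_op M (centre u) = L2_zero M"
  by (simp add: centre_def bounded_operator_diff[OF bounded_operator_mean] mean_op_idem L2_diff_self)

lemma centre_ident: "u \<in> L2 M \<Longrightarrow> mean_op M u = L2_zero M \<Longrightarrow> centre u = u"
  by (simp add: centre_def)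

lemma L2_norm_centre_le:
  assumes "u \<in> L2 M"
  shows "L2_norm M (centre u) \<le> L2_norm M u"
  using C.proj_norm_power2[OF assms] mean_op_eq_proj[OF assms]
  by - (rule power2_le_imp_le, simp_all add: centre_def)

lemma bounded_operator_centre: "bounded_operator M centre"
  by (rule bounded_operator_cong[OF bounded_operator_resolvent[OF bounded_operator_mean, of 1]])
    (simp add: centre_def)

text \<open>Since Q fixes \<Pi> u, Q u - \<Pi> u = Q (u - \<Pi> u). Questions about Q - \<Pi> thus
  reduce to Q on vectors of mean zero.\<close>

lemma op_diff_mean_eq:
  assumes "bounded_operator M Q" "\<And>u. u \<in> L2 M \<Longrightarrow> Q (mean_op M u) = mean_op M u" "u \<in> L2 M"
  shows "op_diff M Q (mean_op M) u = Q (centre u)"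
  using assms by (simp add: op_diff_def centre_def bounded_operator_diff)

lemma bounded_operator_op_diff_mean:
  assumes "bounded_operator M Q" "\<And>u. u \<in> L2 M \<Longrightarrow> Q (mean_op M u) = mean_op M u"
  shows "bounded_operator M (op_diff M Q (mean_op M))"
  by (rule bounded_operator_cong[OF bounded_operator_comp[OF assms(1) bounded_operator_centre]])
    (rule op_diff_mean_eq[OF assms])

text \<open>Centring does not increase the norm, so contraction on mean-zero vectors bounds Q -
  \<Pi> on all vectors by q. This limits operator norm and spectral radius alike.\<close>

lemma contraction_imp_gap:
  assumes Q: "bounded_operator M Q" "\<And>u. u \<in> L2 M \<Longrightarrow> Q (mean_op M u) = mean_op M u"
    and q: "0 \<le> q" "q < 1"
    and con: "\<And>u. u \<in> L2 M \<Longrightarrow> mean_op M u = L2_zero M \<Longrightarrow> L2_norm M (Q u) \<le> q * L2_norm M u"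
  shows "has_spectral_gap M Q" and "op_norm M (op_diff M Q (mean_op M)) < 1"
proof -
  let ?S = "op_diff M Q (mean_op M)"
  have S: "L2_norm M (?S u) \<le> q * L2_norm M u" if u: "u \<in> L2 M" for u
    using order_trans[OF con[of "centre u"] mult_left_mono[OF L2_norm_centre_le[OF u] q(1)]] u
    by (simp add: op_diff_mean_eq[OF Q] mean_op_centre)
  show "op_norm M ?S < 1"
    using op_norm_le[OF S q(1)] q(2) by simp
  \<comment> \<open>The constant 1 is a nonzero vector killed by Q - \<Pi>, the kernel vector that
    \<open>spectral_radius_le\<close> asks for.\<close>
  define one where "one = L2_class M (\<lambda>_. 1)"
  have one: "one \<in> L2 M" by (simp add: one_def L2_class_in_L2 L2_funs_const)
  have rep_one: "AE x in M. rep one x = 1" unfolding one_def by (rule rep_L2_class[OF L2_funs_const])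
  have "(L2_norm M one)\<^sup>2 = (LINT x|M. (cmod 1)\<^sup>2)"
    by (rule L2_norm_cong[OF one _ rep_one]) simp
  then have "one \<noteq> L2_zero M" using L2_norm_eq_0_iff[OF one] by (auto simp: prob_space)
  moreover have "mean_op M one = one"
  proof -
    have [measurable]: "rep one \<in> borel_measurable M" using rep_L2_funs[OF one] by simp
    have "(LINT x|M. rep one x) = (LINT x|M. 1)"
      using rep_one by (intro integral_cong_AE) auto
    then show ?thesis by (simp add: mean_op_def prob_space one_def[symmetric])
  qed
  then have "?S one = L2_zero M"
    using one by (simp add: op_diff_mean_eq[OF Q] centre_def L2_diff_self bounded_operator_zero[OF Q(1)])
  ultimately have "spectral_radius M ?S \<le> q"
    using spectral_radius_le[OF bounded_operator_op_diff_mean[OF Q] S q(1) one] by blast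
  then show "has_spectral_gap M Q"
    using q(2) by (simp add: has_spectral_gap_def)
qed

text \<open>Both kinds of gap bound 1 - Q below on mean-zero vectors: a spectral gap because 1 is
  outside the spectrum of Q - \<Pi>, a norm gap by the triangle inequality.\<close>

lemma gap_imp_bound:
  assumes Q: "bounded_operator M Q" "\<And>u. u \<in> L2 M \<Longrightarrow> Q (mean_op M u) = mean_op M u"
    and gap: "has_spectral_gap M Q \<or> op_norm M (op_diff M Q (mean_op M)) < 1"
  obtains C where "C \<ge> 0" "\<And>u. u \<in> L2 M \<Longrightarrow> mean_op M u = L2_zero M \<Longrightarrow>
    L2_norm M u \<le> C * L2_norm M (L2_diff M u (Q u))"
proof -
  let ?S = "op_diff M Q (mean_op M)"
  note S = bounded_operator_op_diff_mean[OF Q]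
  have SQ: "?S u = Q u" if "u \<in> L2 M" "mean_op M u = L2_zero M" for u
    using that by (simp add: op_diff_mean_eq[OF Q] centre_ident)
  from gap show ?thesis
  proof
    assume "has_spectral_gap M Q"
    then obtain C where "C \<ge> 0" and C: "\<And>u. u \<in> L2 M \<Longrightarrow> L2_norm M u \<le> C * L2_norm M (L2_diff M u (?S u))"
      using spectral_radius_less_1_bound[OF S] unfolding has_spectral_gap_def by blast
    show ?thesis
      by (rule that[OF \<open>C \<ge> 0\<close>]) (use C SQ in metis)
  next
    assume lt: "op_norm M ?S < 1"
    show ?thesis
    proof (rule that[of "1 / (1 - op_norm M ?S)"])
      fix u assume u: "u \<in> L2 M" "mean_op M u = L2_zero M"
      have "L2_norm M u \<le> op_norm M ?S * L2_norm M u + L2_norm M (L2_diff M u (Q u))"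
        using L2_norm_triangle_diff[OF u(1) bounded_operator_in[OF Q(1) u(1)]]
          L2_norm_le_op_norm[OF S u(1)] by (simp add: SQ[OF u])
      then show "L2_norm M u \<le> 1 / (1 - op_norm M ?S) * L2_norm M (L2_diff M u (Q u))"
        using lt by (simp add: field_simps)
    qed (use lt in simp)
  qed
qed

end

section \<open>Products and convex combinations of projections\<close>

lemma convex_sum_power2_le:
  fixes w x :: "'i \<Rightarrow> real"
  assumes "finite A" "\<And>i. i \<in> A \<Longrightarrow> 0 \<le> w i" "sum w A = 1"
  shows "(\<Sum>i\<in>A. w i * x i)\<^sup>2 \<le> (\<Sum>i\<in>A. w i * (x i)\<^sup>2)"
proof -
  have "A \<noteq> {}" using assms(3) by auto
  then show ?thesis
    using convex_on_sum[OF assms(1) _ convex_power2, of w x] assms(2,3) by simp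
qed

text \<open>Jensen's inequality for the square, applied pointwise and integrated. As z is tied to
  the combination only almost everywhere, it can be the mixture Q u as well as u - Q u.\<close>

lemma L2_norm_convex_combination:
  assumes z: "z \<in> L2 M" and v: "\<And>d. d \<in> A \<Longrightarrow> v d \<in> L2 M"
    and A: "finite A" "\<And>d. d \<in> A \<Longrightarrow> 0 \<le> w d" "sum w A = 1"
    and eq: "AE x in M. rep z x = (\<Sum>d\<in>A. complex_of_real (w d) * rep (v d) x)"
  shows "(L2_norm M z)\<^sup>2 \<le> (\<Sum>d\<in>A. w d * (L2_norm M (v d))\<^sup>2)"
proof -
  let ?s = "\<lambda>x. \<Sum>d\<in>A. complex_of_real (w d) * rep (v d) x"
  have s: "?s \<in> L2_funs M"
    by (intro L2_funs_sum L2_funs_scale rep_L2_funs v)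
  have int: "integrable M (\<lambda>x. w d * (cmod (rep (v d) x))\<^sup>2)" if "d \<in> A" for d
    by (intro integrable_mult_right L2_funs_integrable rep_L2_funs v that)
  have pt: "(cmod (?s x))\<^sup>2 \<le> (\<Sum>d\<in>A. w d * (cmod (rep (v d) x))\<^sup>2)" for x
  proof -
    have "cmod (?s x) \<le> (\<Sum>d\<in>A. cmod (complex_of_real (w d) * rep (v d) x))"
      by (rule norm_sum)
    also have "\<dots> = (\<Sum>d\<in>A. w d * cmod (rep (v d) x))"
      using A(2) by (intro sum.cong) (auto simp: norm_mult)
    finally have "(cmod (?s x))\<^sup>2 \<le> (\<Sum>d\<in>A. w d * cmod (rep (v d) x))\<^sup>2"
      by (intro power_mono) auto
    also have "\<dots> \<le> (\<Sum>d\<in>A. w d * (cmod (rep (v d) x))\<^sup>2)"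
      by (rule convex_sum_power2_le[OF A])
    finally show ?thesis .
  qed
  have "(L2_norm M z)\<^sup>2 = (LINT x|M. (cmod (?s x))\<^sup>2)"
    using s eq by (intro L2_norm_cong[OF z] L2_funs_measurable) auto
  also have "\<dots> \<le> (LINT x|M. (\<Sum>d\<in>A. w d * (cmod (rep (v d) x))\<^sup>2))"
    by (intro integral_mono L2_funs_integrable[OF s] Bochner_Integration.integrable_sum int pt)
  also have "\<dots> = (\<Sum>d\<in>A. w d * (L2_norm M (v d))\<^sup>2)"
    using int by (simp add: L2_norm_power2)
  finally show ?thesis .
qed

text \<open>Isolates what the argument takes from the coordinates: complemented subspaces, each
  containing the constants.\<close>

locale projection_family = prob_space M for M :: "'x measure" +
  fixes g :: nat and F :: "nat \<Rightarrow> 'x l2_class set"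
  assumes complemented: "d \<in> {1..g} \<Longrightarrow> L2_complemented M (F d)"
    and mean_op_in_F: "d \<in> {1..g} \<Longrightarrow> mean_op M u \<in> F d"
begin

definition P :: "nat \<Rightarrow> 'x l2_class \<Rightarrow> 'x l2_class" where
  "P d = orth_proj M (F d)"

lemma bounded_operator_P: "d \<in> {1..g} \<Longrightarrow> bounded_operator M (P d)"
  unfolding P_def by (rule L2_complemented.bounded_operator_proj[OF complemented])

lemma P_in_L2 [simp]: "d \<in> {1..g} \<Longrightarrow> u \<in> L2 M \<Longrightarrow> P d u \<in> L2 M"
  by (rule bounded_operator_in[OF bounded_operator_P])

lemma P_mean: "d \<in> {1..g} \<Longrightarrow> P d (mean_op M u) = mean_op M u"
  unfolding P_def by (rule L2_complemented.proj_ident[OF complemented mean_op_in_F])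

lemma P_norm_power2: "d \<in> {1..g} \<Longrightarrow> u \<in> L2 M \<Longrightarrow>
    (L2_norm M u)\<^sup>2 = (L2_norm M (L2_diff M u (P d u)))\<^sup>2 + (L2_norm M (P d u))\<^sup>2"
  unfolding P_def by (rule L2_complemented.proj_norm_power2[OF complemented])

lemma P_norm_le: "d \<in> {1..g} \<Longrightarrow> u \<in> L2 M \<Longrightarrow> L2_norm M (P d u) \<le> L2_norm M u"
  unfolding P_def by (rule L2_complemented.proj_norm_le[OF complemented])

text \<open>P d v is some point of the range, and P d u is the nearest one to u.\<close>

lemma P_nearest: "d \<in> {1..g} \<Longrightarrow> u \<in> L2 M \<Longrightarrow> v \<in> L2 M \<Longrightarrow>
    L2_norm M (L2_diff M u (P d u)) \<le> L2_norm M (L2_diff M u (P d v))"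
  unfolding P_def
  by (rule L2_complemented.proj_nearest[OF complemented _ L2_complemented.proj_in_F[OF complemented]])

section \<open>Products of the projections, indexed by lists to allow induction on the
  factors\<close>

definition prodP :: "nat list \<Rightarrow> 'x l2_class \<Rightarrow> 'x l2_class" where
  "prodP ds = foldr (\<circ>) (map P ds) id"

lemma prodP_Nil [simp]: "prodP [] u = u"
  and prodP_Cons [simp]: "prodP (d # ds) u = P d (prodP ds u)"
  by (simp_all add: prodP_def)

lemma bounded_operator_prodP: "set ds \<subseteq> {1..g} \<Longrightarrow> bounded_operator M (prodP ds)"
proof (induction ds)
  case Nil
  show ?case by (rule bounded_operator_cong[OF bounded_operator_id]) simp
next
  case (Cons d ds)
  then have "bounded_operator M (P d)" "bounded_operator M (prodP ds)"
    by (simp_all add: bounded_operator_P)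
  then have "bounded_operator M (\<lambda>u. P d (prodP ds u))"
    by (rule bounded_operator_comp)
  then show ?case by (rule bounded_operator_cong) simp
qed

lemma prodP_in_L2: "set ds \<subseteq> {1..g} \<Longrightarrow> u \<in> L2 M \<Longrightarrow> prodP ds u \<in> L2 M"
  by (rule bounded_operator_in[OF bounded_operator_prodP])

lemma prodP_mean: "set ds \<subseteq> {1..g} \<Longrightarrow> prodP ds (mean_op M u) = mean_op M u"
  by (induction ds) (auto simp: P_mean)

text \<open>Telescoping: u - P d v = (u - P d u) + P d (u - v) with v the product of the remaining
  factors, and P d does not increase the norm. Each factor adds at most s.\<close>

lemma norm_diff_prodP_le:
  assumes "u \<in> L2 M" "set ds \<subseteq> {1..g}"
    and "\<And>d. d \<in> set ds \<Longrightarrow> L2_norm M (L2_diff M u (P d u)) \<le> s"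
  shows "L2_norm M (L2_diff M u (prodP ds u)) \<le> real (length ds) * s"
  using assms(2,3)
proof (induction ds)
  case Nil
  then show ?case using assms(1) by (simp add: L2_diff_self)
next
  case (Cons d ds)
  then have d: "d \<in> {1..g}" and ds: "set ds \<subseteq> {1..g}" by auto
  note v = prodP_in_L2[OF ds assms(1)]
  have "L2_norm M (L2_diff M u (prodP (d # ds) u))
      \<le> L2_norm M (L2_diff M u (P d u)) + L2_norm M (L2_diff M (P d u) (P d (prodP ds u)))"
    using L2_norm_triangle3[of u M "P d u" "P d (prodP ds u)"] assms(1) v d by simp
  also have "L2_diff M (P d u) (P d (prodP ds u)) = P d (L2_diff M u (prodP ds u))"
    using bounded_operator_diff[OF bounded_operator_P[OF d] assms(1) v] by simp
  also have "L2_norm M (P d (L2_diff M u (prodP ds u))) \<le> L2_norm M (L2_diff M u (prodP ds u))"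
    using d v assms(1) by (intro P_norm_le) auto
  also have "\<dots> \<le> real (length ds) * s"
    using Cons ds by auto
  finally show ?case using Cons.prems(2)[of d] by (simp add: distrib_right)
qed

text \<open>By Pythagoras each factor moves the vector by at most the square root of the
  total loss of squared norm; the distance from \<open>u\<close> to the range of \<open>P d\<close> is at most
  the distance from \<open>u\<close> to the partial product ending with \<open>P d\<close>.\<close>

lemma prodP_loss:
  assumes u: "u \<in> L2 M" and "set ds \<subseteq> {1..g}"
  defines "\<delta> \<equiv> \<lambda>ds. (L2_norm M u)\<^sup>2 - (L2_norm M (prodP ds u))\<^sup>2"
  shows "\<delta> ds \<ge> 0 \<and>
    L2_norm M (L2_diff M u (prodP ds u)) \<le> real (length ds) * sqrt (\<delta> ds) \<and>
    (\<forall>d\<in>set ds. L2_norm M (L2_diff M u (P d u)) \<le> real (length ds) * sqrt (\<delta> ds))"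
  using assms(2)
proof (induction ds)
  case Nil
  then show ?case using u by (simp add: \<delta>_def L2_diff_self)
next
  case (Cons d ds)
  then have d: "d \<in> {1..g}" and ds: "set ds \<subseteq> {1..g}" by auto
  define v where "v = prodP ds u"
  have v: "v \<in> L2 M" unfolding v_def by (rule prodP_in_L2[OF ds u])
  note IH = Cons.IH[OF ds]
  have step: "(L2_norm M (L2_diff M v (P d v)))\<^sup>2 = \<delta> (d # ds) - \<delta> ds"
    using P_norm_power2[OF d v] by (simp add: \<delta>_def v_def[symmetric])
  then have mono: "\<delta> ds \<le> \<delta> (d # ds)"
    using zero_le_power2[of "L2_norm M (L2_diff M v (P d v))"] by linarith
  \<comment> \<open>The loss of the remaining factors is nonnegative by induction, so one
    displacement squared costs at most the total loss.\<close>
  have "(L2_norm M (L2_diff M v (P d v)))\<^sup>2 \<le> \<delta> (d # ds)"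
    using step IH by linarith
  then have s: "L2_norm M (L2_diff M v (P d v)) \<le> sqrt (\<delta> (d # ds))"
    by (rule real_le_rsqrt)
  have len: "real (length ds) * sqrt (\<delta> ds) \<le> real (length ds) * sqrt (\<delta> (d # ds))"
    using mono by (intro mult_left_mono) auto
  have total: "L2_norm M (L2_diff M u (P d v)) \<le> real (length (d # ds)) * sqrt (\<delta> (d # ds))"
    using L2_norm_triangle3[OF u v P_in_L2[OF d v]] IH s len
    by (simp add: v_def[symmetric] distrib_right)
  have "L2_norm M (L2_diff M u (P e u)) \<le> real (length (d # ds)) * sqrt (\<delta> (d # ds))"
    if "e \<in> set (d # ds)" for e
  proof (cases "e = d")
    case True
    then show ?thesis using P_nearest[OF d u v] total by simp
  next
    case False
    then have "L2_norm M (L2_diff M u (P e u)) \<le> real (length ds) * sqrt (\<delta> ds)"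
      using IH that by auto
    also have "\<dots> \<le> real (length (d # ds)) * sqrt (\<delta> (d # ds))"
      using mono IH by (intro mult_mono) auto
    finally show ?thesis .
  qed
  then show ?case
    using total mono IH by (auto simp: v_def[symmetric])
qed

text \<open>The condition involves neither an order nor weights, which is why existence for one
  choice and validity for all choices coincide.\<close>

definition joint_gap :: "real \<Rightarrow> bool" where
  "joint_gap c \<longleftrightarrow> c > 0 \<and> (\<forall>u\<in>L2 M. mean_op M u = L2_zero M \<longrightarrow>
     c * (L2_norm M u)\<^sup>2 \<le> (\<Sum>d = 1..g. (L2_norm M (L2_diff M u (P d u)))\<^sup>2))"

lemma joint_gapI:
  assumes "C \<ge> 0"
    and C: "\<And>u. u \<in> L2 M \<Longrightarrow> mean_op M u = L2_zero M \<Longrightarrow>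
      L2_norm M u \<le> C * sqrt (\<Sum>d = 1..g. (L2_norm M (L2_diff M u (P d u)))\<^sup>2)"
  shows "\<exists>c. joint_gap c"
\<comment> \<open>Squaring the bound suggests 1 / C^2; adding 1 keeps the denominator positive when
  C = 0.\<close>
proof (rule exI[of _ "1 / (C\<^sup>2 + 1)"], unfold joint_gap_def, intro conjI ballI impI)
  have pos: "C\<^sup>2 + 1 > 0" by (rule add_nonneg_pos) auto
  then show "1 / (C\<^sup>2 + 1) > 0" by simp
  fix u assume u: "u \<in> L2 M" "mean_op M u = L2_zero M"
  define S where "S = (\<Sum>d = 1..g. (L2_norm M (L2_diff M u (P d u)))\<^sup>2)"
  have S: "S \<ge> 0" unfolding S_def by (intro sum_nonneg) auto
  have "(L2_norm M u)\<^sup>2 \<le> (C * sqrt S)\<^sup>2"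
    using C[OF u] unfolding S_def by (intro power_mono) auto
  also have "\<dots> = C\<^sup>2 * S" using S by (simp add: power_mult_distrib)
  also have "\<dots> \<le> (C\<^sup>2 + 1) * S" using S by (simp add: distrib_right)
  finally show "1 / (C\<^sup>2 + 1) * (L2_norm M u)\<^sup>2 \<le> (\<Sum>d = 1..g. (L2_norm M (L2_diff M u (P d u)))\<^sup>2)"
    unfolding S_def[symmetric] using pos by (simp add: field_simps)
qed

lemma norm_diff_P_le:
  assumes "d \<in> {1..g}"
  shows "L2_norm M (L2_diff M u (P d u)) \<le> sqrt (\<Sum>d = 1..g. (L2_norm M (L2_diff M u (P d u)))\<^sup>2)"
  by (intro real_le_rsqrt member_le_sum[OF assms, of "\<lambda>d. (L2_norm M (L2_diff M u (P d u)))\<^sup>2"]) auto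

text \<open>The gap bounds u by u - Q u, which telescopes into single displacements, each dominated
  by the root of their joint sum of squares.\<close>

lemma prodP_imp_joint_gap:
  assumes ds: "set ds \<subseteq> {1..g}"
    and gap: "has_spectral_gap M (prodP ds) \<or> op_norm M (op_diff M (prodP ds) (mean_op M)) < 1"
  shows "\<exists>c. joint_gap c"
proof -
  obtain C where C: "C \<ge> 0" "\<And>u. u \<in> L2 M \<Longrightarrow> mean_op M u = L2_zero M \<Longrightarrow>
    L2_norm M u \<le> C * L2_norm M (L2_diff M u (prodP ds u))"
    using gap_imp_bound[OF bounded_operator_prodP[OF ds] prodP_mean[OF ds] gap] by blast
  show ?thesis
  proof (rule joint_gapI[of "C * real (length ds)"])
    fix u assume u: "u \<in> L2 M" "mean_op M u = L2_zero M"
    let ?s = "sqrt (\<Sum>d = 1..g. (L2_norm M (L2_diff M u (P d u)))\<^sup>2)"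
    have "L2_norm M (L2_diff M u (prodP ds u)) \<le> real (length ds) * ?s"
      using ds by (intro norm_diff_prodP_le[OF u(1) ds] norm_diff_P_le) auto
    from order_trans[OF C(2)[OF u] mult_left_mono[OF this C(1)]]
    show "L2_norm M u \<le> C * real (length ds) * ?s" by (simp add: mult.assoc)
  qed (use C in simp)
qed

text \<open>Every index must occur in the list, since \<open>prodP_loss\<close> controls only the
  projections that appear. The joint gap then forces a definite proportion of the squared norm to be
  lost.\<close>

lemma joint_gap_imp_prodP:
  assumes c: "joint_gap c" and ds: "set ds = {1..g}"
  shows "has_spectral_gap M (prodP ds)" and "op_norm M (op_diff M (prodP ds) (mean_op M)) < 1"
proof -
  define n where "n = real (length ds)"
  \<comment> \<open>If \<delta> is the loss of squared norm, the sum of squared displacements is at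
    most g n^2 \<delta>, so \<delta> is at least b times the squared norm of u; the added 1 excludes
    a zero denominator.\<close>
  define b where "b = c / (real g * n\<^sup>2 + 1)"
  have den: "real g * n\<^sup>2 + 1 > 0" by (rule add_nonneg_pos) auto
  have "b > 0" using c den by (simp add: b_def joint_gap_def)
  \<comment> \<open>The maximum keeps q nonnegative when b exceeds 1.\<close>
  define q where "q = sqrt (max 0 (1 - b))"
  have q: "0 \<le> q" "q < 1" using \<open>b > 0\<close> by (auto simp: q_def)
  have con: "L2_norm M (prodP ds u) \<le> q * L2_norm M u"
    if u: "u \<in> L2 M" "mean_op M u = L2_zero M" for u
  proof -
    define \<delta> where "\<delta> = (L2_norm M u)\<^sup>2 - (L2_norm M (prodP ds u))\<^sup>2"
    have \<delta>: "\<delta> \<ge> 0" "\<And>d. d \<in> {1..g} \<Longrightarrow> L2_norm M (L2_diff M u (P d u)) \<le> n * sqrt \<delta>"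
      using prodP_loss[OF u(1), of ds] ds unfolding \<delta>_def n_def by auto
    have "c * (L2_norm M u)\<^sup>2 \<le> (\<Sum>d = 1..g. (L2_norm M (L2_diff M u (P d u)))\<^sup>2)"
      using c u by (simp add: joint_gap_def)
    also have "\<dots> \<le> (\<Sum>d = 1..g. (n * sqrt \<delta>)\<^sup>2)"
      using \<delta>(2) by (intro sum_mono power_mono) auto
    also have "\<dots> = real g * n\<^sup>2 * \<delta>"
      using \<delta>(1) by (simp add: power_mult_distrib)
    also have "\<dots> \<le> (real g * n\<^sup>2 + 1) * \<delta>"
      using \<delta>(1) by (simp add: distrib_right)
    finally have "b * (L2_norm M u)\<^sup>2 \<le> \<delta>"
      using den by (simp add: b_def field_simps)
    then have "(L2_norm M (prodP ds u))\<^sup>2 \<le> (1 - b) * (L2_norm M u)\<^sup>2"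
      by (simp add: \<delta>_def left_diff_distrib)
    also have "\<dots> \<le> max 0 (1 - b) * (L2_norm M u)\<^sup>2"
      by (intro mult_right_mono) auto
    also have "\<dots> = (q * L2_norm M u)\<^sup>2"
      by (simp add: q_def power_mult_distrib)
    finally show ?thesis
      by (rule power2_le_imp_le) (use q in simp)
  qed
  have ds': "set ds \<subseteq> {1..g}" using ds by simp
  from contraction_imp_gap[OF bounded_operator_prodP[OF ds'] prodP_mean[OF ds'] q con]
  show "has_spectral_gap M (prodP ds)" "op_norm M (op_diff M (prodP ds) (mean_op M)) < 1"
    by blast+
qed

section \<open>Convex combinations of the projections\<close>

lemma mix_in_L2: "u \<in> L2 M \<Longrightarrow> op_mix M g w P u \<in> L2 M"
  unfolding op_mix_def by (intro L2_class_in_L2 L2_funs_sum L2_funs_scale rep_L2_funs P_in_L2)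

lemma rep_mix:
  "u \<in> L2 M \<Longrightarrow> AE x in M. rep (op_mix M g w P u) x = (\<Sum>d = 1..g. complex_of_real (w d) * rep (P d u) x)"
  unfolding op_mix_def by (intro rep_L2_class L2_funs_sum L2_funs_scale rep_L2_funs P_in_L2)

lemma weights_nonneg: "w \<in> weights g \<Longrightarrow> d \<in> {1..g} \<Longrightarrow> 0 \<le> w d"
  and weights_sum: "w \<in> weights g \<Longrightarrow> sum w {1..g} = 1"
  by (auto simp: weights_def less_imp_le)

lemma mix_norm_power2_le:
  assumes "w \<in> weights g" "u \<in> L2 M"
  shows "(L2_norm M (op_mix M g w P u))\<^sup>2 \<le> (\<Sum>d = 1..g. w d * (L2_norm M (P d u))\<^sup>2)"
  by (rule L2_norm_convex_combination[OF mix_in_L2[OF assms(2)] P_in_L2[OF _ assms(2)] finite_atLeastAtMost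
        weights_nonneg[OF assms(1)] weights_sum[OF assms(1)] rep_mix[OF assms(2)]])

text \<open>As the weights sum to 1, u - Q u is the same convex combination of the residuals u - P d
  u.\<close>

lemma mix_norm_diff_power2_le:
  assumes w: "w \<in> weights g" and u: "u \<in> L2 M"
  shows "(L2_norm M (L2_diff M u (op_mix M g w P u)))\<^sup>2 \<le> (\<Sum>d = 1..g. w d * (L2_norm M (L2_diff M u (P d u)))\<^sup>2)"
proof (rule L2_norm_convex_combination[OF L2_diff_in[OF u mix_in_L2[OF u]] L2_diff_in[OF u P_in_L2[OF _ u]]
      finite_atLeastAtMost weights_nonneg[OF w] weights_sum[OF w]])
  \<comment> \<open>There are finitely many exceptional null sets, one for each d, so a single one
    serves all summands.\<close>
  have "AE x in M. \<forall>d\<in>{1..g}. rep (L2_diff M u (P d u)) x = rep u x - rep (P d u) x"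
    using u by (intro AE_finite_allI rep_L2_diff) auto
  then show "AE x in M. rep (L2_diff M u (op_mix M g w P u)) x =
      (\<Sum>d = 1..g. complex_of_real (w d) * rep (L2_diff M u (P d u)) x)"
    using rep_L2_diff[OF u mix_in_L2[OF u, of w]] rep_mix[OF u, of w]
  proof eventually_elim
    case (elim x)
    have "(\<Sum>d = 1..g. complex_of_real (w d) * rep (L2_diff M u (P d u)) x)
        = (\<Sum>d = 1..g. complex_of_real (w d)) * rep u x - (\<Sum>d = 1..g. complex_of_real (w d) * rep (P d u) x)"
      using elim(1) by (simp add: right_diff_distrib sum_subtractf sum_distrib_right)
    also have "(\<Sum>d = 1..g. complex_of_real (w d)) = 1"
      using weights_sum[OF w] by (metis of_real_1 of_real_sum)
    finally show ?case using elim(2,3) by simp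
  qed
qed

text \<open>The weighted average of the Pythagorean identities for the P d.\<close>

lemma mix_norm_power2_eq:
  assumes w: "w \<in> weights g" and u: "u \<in> L2 M"
  shows "(\<Sum>d = 1..g. w d * (L2_norm M (P d u))\<^sup>2)
    = (L2_norm M u)\<^sup>2 - (\<Sum>d = 1..g. w d * (L2_norm M (L2_diff M u (P d u)))\<^sup>2)"
proof -
  have "(\<Sum>d = 1..g. w d * (L2_norm M (P d u))\<^sup>2)
      = (\<Sum>d = 1..g. w d * ((L2_norm M u)\<^sup>2 - (L2_norm M (L2_diff M u (P d u)))\<^sup>2))"
    using P_norm_power2[OF _ u] by (intro sum.cong refl) simp
  also have "\<dots> = sum w {1..g} * (L2_norm M u)\<^sup>2 - (\<Sum>d = 1..g. w d * (L2_norm M (L2_diff M u (P d u)))\<^sup>2)"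
    by (simp add: right_diff_distrib sum_subtractf sum_distrib_right)
  finally show ?thesis unfolding weights_sum[OF w] by simp
qed

lemma bounded_operator_mix:
  assumes w: "w \<in> weights g"
  shows "bounded_operator M (op_mix M g w P)"
proof (rule bounded_operatorI[where C=1])
  fix u v assume u: "u \<in> L2 M" and v: "v \<in> L2 M"
  have "AE x in M. \<forall>d\<in>{1..g}. rep (L2_add M (P d u) (P d v)) x = rep (P d u) x + rep (P d v) x"
    using u v by (intro AE_finite_allI rep_L2_add) auto
  then have "AE x in M. rep (op_mix M g w P (L2_add M u v)) x =
      rep (L2_add M (op_mix M g w P u) (op_mix M g w P v)) x"
    using rep_mix[OF u, of w] rep_mix[OF v, of w] rep_mix[OF L2_add_in[OF u v], of w]
      rep_L2_add[OF mix_in_L2[OF u, of w] mix_in_L2[OF v, of w]]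
  proof eventually_elim
    case (elim x)
    then show ?case
      using u v by (simp add: bounded_operator_add[OF bounded_operator_P] distrib_left sum.distrib)
  qed
  then show "op_mix M g w P (L2_add M u v) = L2_add M (op_mix M g w P u) (op_mix M g w P v)"
    using u v by (intro L2_eqI[of _ M]) (auto simp: mix_in_L2)
next
  fix c u assume u: "u \<in> L2 M"
  have "AE x in M. \<forall>d\<in>{1..g}. rep (L2_scale M c (P d u)) x = c * rep (P d u) x"
    using u by (intro AE_finite_allI rep_L2_scale) auto
  then have "AE x in M. rep (op_mix M g w P (L2_scale M c u)) x =
      rep (L2_scale M c (op_mix M g w P u)) x"
    using rep_mix[OF u, of w] rep_mix[OF L2_scale_in[OF u], of w c]
      rep_L2_scale[OF mix_in_L2[OF u, of w], of c]
  proof eventually_elim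
    case (elim x)
    then show ?case
      using u by (simp add: bounded_operator_scale[OF bounded_operator_P] sum_distrib_left mult.left_commute)
  qed
  then show "op_mix M g w P (L2_scale M c u) = L2_scale M c (op_mix M g w P u)"
    using u by (intro L2_eqI[of _ M]) (auto simp: mix_in_L2)
next
  fix u assume u: "u \<in> L2 M"
  have "(\<Sum>d = 1..g. w d * (L2_norm M (L2_diff M u (P d u)))\<^sup>2) \<ge> 0"
    using weights_nonneg[OF w] by (intro sum_nonneg) auto
  then have "(L2_norm M (op_mix M g w P u))\<^sup>2 \<le> (L2_norm M u)\<^sup>2"
    using mix_norm_power2_le[OF w u] mix_norm_power2_eq[OF w u] by linarith
  then have "L2_norm M (op_mix M g w P u) \<le> L2_norm M u"
    by (rule power2_le_imp_le) simp
  then show "L2_norm M (op_mix M g w P u) \<le> 1 * L2_norm M u" by simp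
qed (simp add: mix_in_L2)

lemma mix_mean:
  assumes w: "w \<in> weights g"
  shows "op_mix M g w P (mean_op M u) = mean_op M u"
proof -
  have "AE x in M. rep (op_mix M g w P (mean_op M u)) x = rep (mean_op M u) x"
    using rep_mix[OF mean_op_in_L2, of w u]
  proof eventually_elim
    case (elim x)
    then have "rep (op_mix M g w P (mean_op M u)) x = (\<Sum>d = 1..g. complex_of_real (w d)) * rep (mean_op M u) x"
      by (simp add: P_mean sum_distrib_right)
    also have "(\<Sum>d = 1..g. complex_of_real (w d)) = 1"
      using weights_sum[OF w] by (metis of_real_1 of_real_sum)
    finally show ?case by simp
  qed
  then show ?thesis by (intro L2_eqI[of _ M]) (auto simp: mix_in_L2)
qed

lemma mix_imp_joint_gap:
  assumes w: "w \<in> weights g" and gap: "has_spectral_gap M (op_mix M g w P)"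
  shows "\<exists>c. joint_gap c"
proof -
  obtain C where C: "C \<ge> 0" "\<And>u. u \<in> L2 M \<Longrightarrow> mean_op M u = L2_zero M \<Longrightarrow>
    L2_norm M u \<le> C * L2_norm M (L2_diff M u (op_mix M g w P u))"
    using gap_imp_bound[OF bounded_operator_mix[OF w] mix_mean[OF w]] gap by blast
  show ?thesis
  proof (rule joint_gapI[OF C(1)])
    fix u assume u: "u \<in> L2 M" "mean_op M u = L2_zero M"
    have "(L2_norm M (L2_diff M u (op_mix M g w P u)))\<^sup>2
        \<le> (\<Sum>d = 1..g. w d * (L2_norm M (L2_diff M u (P d u)))\<^sup>2)"
      by (rule mix_norm_diff_power2_le[OF w u(1)])
    \<comment> \<open>Each weight is at most 1, so replacing it by 1 yields the sum in the joint
      gap.\<close>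
    also have "\<dots> \<le> (\<Sum>d = 1..g. 1 * (L2_norm M (L2_diff M u (P d u)))\<^sup>2)"
      using w by (intro sum_mono mult_right_mono) (auto simp: weights_def less_imp_le)
    finally have "L2_norm M (L2_diff M u (op_mix M g w P u))
        \<le> sqrt (\<Sum>d = 1..g. (L2_norm M (L2_diff M u (P d u)))\<^sup>2)"
      by (intro real_le_rsqrt) simp
    from order_trans[OF C(2)[OF u] mult_left_mono[OF this C(1)]]
    show "L2_norm M u \<le> C * sqrt (\<Sum>d = 1..g. (L2_norm M (L2_diff M u (P d u)))\<^sup>2)" .
  qed
qed

lemma joint_gap_imp_mix:
  assumes c: "joint_gap c" and w: "w \<in> weights g"
  shows "has_spectral_gap M (op_mix M g w P)"
proof -
  have "g \<ge> 1"
    using weights_sum[OF w] by (cases g) auto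
  \<comment> \<open>The least of finitely many positive weights is positive and compares the
    weighted sum of squares with the unweighted one; a fraction m c of the squared norm is
    lost.\<close>
  define m where "m = Min (w ` {1..g})"
  have m: "m > 0" "\<And>d. d \<in> {1..g} \<Longrightarrow> m \<le> w d"
    using w \<open>g \<ge> 1\<close> by (auto simp: m_def weights_def)
  define q where "q = sqrt (max 0 (1 - m * c))"
  have "m * c > 0" using m(1) c by (simp add: joint_gap_def)
  then have q: "0 \<le> q" "q < 1" by (auto simp: q_def)
  have con: "L2_norm M (op_mix M g w P u) \<le> q * L2_norm M u"
    if u: "u \<in> L2 M" "mean_op M u = L2_zero M" for u
  proof -
    have "m * c * (L2_norm M u)\<^sup>2 \<le> m * (\<Sum>d = 1..g. (L2_norm M (L2_diff M u (P d u)))\<^sup>2)"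
      using c u m(1) by (simp add: joint_gap_def mult.assoc)
    also have "\<dots> \<le> (\<Sum>d = 1..g. w d * (L2_norm M (L2_diff M u (P d u)))\<^sup>2)"
      unfolding sum_distrib_left using m(2) by (intro sum_mono mult_right_mono) auto
    finally have "(L2_norm M (op_mix M g w P u))\<^sup>2 \<le> (1 - m * c) * (L2_norm M u)\<^sup>2"
      using mix_norm_power2_le[OF w u(1)] mix_norm_power2_eq[OF w u(1)]
      by (simp add: left_diff_distrib)
    also have "\<dots> \<le> max 0 (1 - m * c) * (L2_norm M u)\<^sup>2"
      by (intro mult_right_mono) auto
    also have "\<dots> = (q * L2_norm M u)\<^sup>2"
      by (simp add: q_def power_mult_distrib)
    finally show ?thesis
      by (rule power2_le_imp_le) (use q in simp)
  qed
  show ?thesis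
    by (rule contraction_imp_gap(1)[OF bounded_operator_mix[OF w] mix_mean[OF w] q con])
qed

section \<open>Equivalence of the six statements\<close>

lemma op_prod_permuted:
  assumes "\<rho> permutes {1..g}"
  obtains ds where "set ds = {1..g}" "op_prod g (\<lambda>d. P (\<rho> d)) = prodP ds"
proof (rule that[of "map \<rho> [1..<Suc g]"])
  show "set (map \<rho> [1..<Suc g]) = {1..g}"
    using permutes_image[OF assms] by (simp add: atLeastLessThanSuc_atLeastAtMost del: upt_Suc)
  show "op_prod g (\<lambda>d. P (\<rho> d)) = prodP (map \<rho> [1..<Suc g])"
    by (simp add: op_prod_def prodP_def o_def del: upt_Suc)
qed

text \<open>Each single permutation or weight vector is already equivalent to the joint gap, so both
  quantifiers give the same truth value once some choice exists.\<close>

lemma all_iff_joint_gap: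
  assumes "g \<ge> 2"
  defines "G \<equiv> \<exists>c. joint_gap c"
  shows "(\<exists>\<rho>. \<rho> permutes {1..g} \<and> has_spectral_gap M (op_prod g (\<lambda>d. P (\<rho> d)))) = G"
    and "(\<exists>w\<in>weights g. has_spectral_gap M (op_mix M g w P)) = G"
    and "(\<exists>\<rho>. \<rho> permutes {1..g} \<and>
       op_norm M (op_diff M (op_prod g (\<lambda>d. P (\<rho> d))) (mean_op M)) < 1) = G"
    and "(\<forall>\<rho>. \<rho> permutes {1..g} \<longrightarrow> has_spectral_gap M (op_prod g (\<lambda>d. P (\<rho> d)))) = G"
    and "(\<forall>w\<in>weights g. has_spectral_gap M (op_mix M g w P)) = G"
    and "(\<forall>\<rho>. \<rho> permutes {1..g} \<longrightarrow>
       op_norm M (op_diff M (op_prod g (\<lambda>d. P (\<rho> d))) (mean_op M)) < 1) = G"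
proof -
  have id: "id permutes {1..g}" by (rule permutes_id)
  \<comment> \<open>Uniform weights lie in the open interval (0,1) because g \<ge> 2; for g = 1 the
    only candidate would be 1.\<close>
  have "(\<lambda>_. 1 / real g) \<in> weights g"
    using assms(1) by (simp add: weights_def)
  then have wex: "\<exists>w. w \<in> weights g" by blast
  have prod: "has_spectral_gap M (op_prod g (\<lambda>d. P (\<rho> d))) = G"
    "(op_norm M (op_diff M (op_prod g (\<lambda>d. P (\<rho> d))) (mean_op M)) < 1) = G"
    if \<rho>: "\<rho> permutes {1..g}" for \<rho>
  proof -
    obtain ds where ds: "set ds = {1..g}" and eq: "op_prod g (\<lambda>d. P (\<rho> d)) = prodP ds"
      using op_prod_permuted[OF \<rho>] by blast
    show "has_spectral_gap M (op_prod g (\<lambda>d. P (\<rho> d))) = G"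
      "(op_norm M (op_diff M (op_prod g (\<lambda>d. P (\<rho> d))) (mean_op M)) < 1) = G"
      unfolding eq G_def using prodP_imp_joint_gap[of ds] joint_gap_imp_prodP[OF _ ds] ds by blast+
  qed
  have mix: "has_spectral_gap M (op_mix M g w P) = G" if "w \<in> weights g" for w
    unfolding G_def using mix_imp_joint_gap[OF that] joint_gap_imp_mix[OF _ that] by blast
  show "(\<exists>\<rho>. \<rho> permutes {1..g} \<and> has_spectral_gap M (op_prod g (\<lambda>d. P (\<rho> d)))) = G"
    "(\<forall>\<rho>. \<rho> permutes {1..g} \<longrightarrow> has_spectral_gap M (op_prod g (\<lambda>d. P (\<rho> d)))) = G"
    using prod(1) id by blast+
  show "(\<exists>w\<in>weights g. has_spectral_gap M (op_mix M g w P)) = G"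
    "(\<forall>w\<in>weights g. has_spectral_gap M (op_mix M g w P)) = G"
    using mix wex by blast+
  show "(\<exists>\<rho>. \<rho> permutes {1..g} \<and>
       op_norm M (op_diff M (op_prod g (\<lambda>d. P (\<rho> d))) (mean_op M)) < 1) = G"
    "(\<forall>\<rho>. \<rho> permutes {1..g} \<longrightarrow>
       op_norm M (op_diff M (op_prod g (\<lambda>d. P (\<rho> d))) (mean_op M)) < 1) = G"
    using prod(2) id by blast+
qed

end

theorem corollary3p5:
  fixes K g :: nat
    and X :: "nat \<Rightarrow> 'a metric"
    and \<pi> :: "(nat \<Rightarrow> 'a) measure"
    and I :: "nat \<Rightarrow> nat set"
    and P :: "nat \<Rightarrow> (nat \<Rightarrow> 'a) l2_class \<Rightarrow> (nat \<Rightarrow> 'a) l2_class"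
  assumes "K \<ge> 2"
    and "\<And>k. k \<in> {1..K} \<Longrightarrow> mcomplete_of (X k)"
    and "\<And>k. k \<in> {1..K} \<Longrightarrow> separable_space (mtopology_of (X k))"
    and "prob_space \<pi>"
    and "sets \<pi> = sets (borel_of (product_topology (\<lambda>k. mtopology_of (X k)) {1..K}))"
    and "\<And>d. d \<in> {1..g} \<Longrightarrow> I d \<noteq> {} \<and> I d \<subset> {1..K}"
    and "(\<Union>d\<in>{1..g}. I d) = {1..K}"
  defines "P \<equiv> \<lambda>d. orth_proj \<pi> (const_in K \<pi> (I d))"
  shows "all_equivalent
    [\<exists>\<rho>. \<rho> permutes {1..g} \<and> has_spectral_gap \<pi> (op_prod g (\<lambda>d. P (\<rho> d))),
     \<exists>w\<in>weights g. has_spectral_gap \<pi> (op_mix \<pi> g w P),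
     \<exists>\<rho>. \<rho> permutes {1..g} \<and>
       op_norm \<pi> (op_diff \<pi> (op_prod g (\<lambda>d. P (\<rho> d))) (mean_op \<pi>)) < 1,
     \<forall>\<rho>. \<rho> permutes {1..g} \<longrightarrow> has_spectral_gap \<pi> (op_prod g (\<lambda>d. P (\<rho> d))),
     \<forall>w\<in>weights g. has_spectral_gap \<pi> (op_mix \<pi> g w P),
     \<forall>\<rho>. \<rho> permutes {1..g} \<longrightarrow>
       op_norm \<pi> (op_diff \<pi> (op_prod g (\<lambda>d. P (\<rho> d))) (mean_op \<pi>)) < 1]"
proof -
  interpret prob_space \<pi> by fact
  \<comment> \<open>Agreement in all coordinates outside J is a symmetric relation, so the general
    theory of invariant classes applies.\<close>
  have const: "const_in K \<pi> J = invariant_classes \<pi> (\<lambda>x y. \<forall>i\<in>{1..K} - J. x i = y i)" for J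
    by (simp add: const_in_def invariant_classes_def)
  interpret fam: projection_family \<pi> g "\<lambda>d. const_in K \<pi> (I d)"
  proof (rule projection_family.intro[OF prob_space_axioms], rule projection_family_axioms.intro)
    fix d u
    show "L2_complemented \<pi> (const_in K \<pi> (I d))"
      unfolding const by (rule L2_complemented_invariant_classes) (simp add: symp_def)
    show "mean_op \<pi> u \<in> const_in K \<pi> (I d)"
      unfolding const by (rule mean_op_in)
  qed
  \<comment> \<open>An empty union cannot cover the nonempty {1..K}, and one set covering it would
    not be proper; hence g \<ge> 2.\<close>
  have "g \<noteq> 0" using assms(1,7) by (intro notI) simp
  moreover have "g \<noteq> 1"
  proof
    assume "g = 1"
    with assms(6)[of 1] assms(7) show False by simp
  qed
  ultimately have "g \<ge> 2" by linarith
  have P: "P = fam.P" by (simp add: P_def fam.P_def fun_eq_iff)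
  show ?thesis
    unfolding P all_equivalent_def fam.all_iff_joint_gap[OF \<open>g \<ge> 2\<close>] by simp
qed

end
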